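(* Let $n\ge 3$ and $r\ge 0$ be integers, and let $I_n=I(L_n^c)\subseteq R_n$ be the edge ideal of the complement $L_n^c$ of the line graph on $[n]$. Then the ideal $\mathrm{Inc}(\mathbb{N})_{n,n+r}(I_n)\subseteq R_{n+r}$ is Cohen--Macaulay.
   Context: Let $k$ be a field, $R_m=k[x_1,\dots,x_m]$ and $[m]=\{1,\dots,m\}$. For $n\le m$, $\mathrm{Inc}(\mathbb{N})_{n,m}$ is the set of strictly increasing functions $\pi:[n]\to[m]$; each such $\pi$ induces the $k$-algebra homomorphism $\pi:R_n\to R_m$, $x_i\mapsto x_{\pi(i)}$. For an ideal $I\subseteq R_n$, $\mathrm{Inc}(\mathbb{N})_{n,m}(I):=\sum_{\pi\in\mathrm{Inc}(\mathbb{N})_{n,m}}\pi(I)R_m$, the ideal of $R_m$ generated by the images of $I$ under all such $\pi$. The edge ideal of a simple graph $G$ on $[n]$ is $I(G)=(x_ix_j : \{i,j\}\in E(G))\subseteq R_n$. The graph $L_n^c$ on $[n]$ is the complement of the path with edges $\{i,i+1\}$, $1\le i\le n-1$; i.e. for $i<j$, $\{i,j\}$ is an edge of $L_n^c$ exactly when $j>i+1$. An ideal $I\subseteq R_m$ is called Cohen--Macaulay if the (graded) quotient ring $R_m/I$ is Cohen--Macaulay, i.e. $\operatorname{depth}(R_m/I)=\dim(R_m/I)$. *)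

theory Defs
  imports
    "HOL-Algebra.Algebra"
    "HOL-Library.Poly_Mapping"
    "HOL-Library.Extended_Nat"
    "HOL-Library.FuncSet"
begin

section \<open>Polynomial rings\<close>

text \<open>
  A polynomial over \<open>'k\<close> in the variables \<open>x\<^sub>0, x\<^sub>1, x\<^sub>2, \<dots>\<close> is a finitely supported map from
  monomials (finitely supported exponent vectors) to coefficients; multiplication on
  \<^theory>\<open>HOL-Library.Poly_Mapping\<close> is convolution.  The ring \<open>R\<^sub>m\<close> is the subring of those
  polynomials in which only \<open>x\<^sub>1, \<dots>, x\<^sub>m\<close> occur.
\<close>

type_synonym 'k mpoly = "(nat \<Rightarrow>\<^sub>0 nat) \<Rightarrow>\<^sub>0 'k"

definition var :: "nat \<Rightarrow> 'k::field mpoly" where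
  "var i = Poly_Mapping.single (Poly_Mapping.single i 1) 1"

definition scalar :: "'k::field \<Rightarrow> 'k mpoly" where
  "scalar c = Poly_Mapping.single 0 c"

definition poly_ring_in :: "nat \<Rightarrow> 'k::field mpoly ring" where
  "poly_ring_in m =
    \<lparr> carrier = {p. \<forall>t \<in> Poly_Mapping.keys p. Poly_Mapping.keys t \<subseteq> {1..m}},
      monoid.mult = (*), monoid.one = 1, ring.zero = 0, ring.add = (+) \<rparr>"

text \<open>The \<open>k\<close>-algebra homomorphism with \<open>x\<^sub>i \<mapsto> x\<^bsub>\<pi>(i)\<^esub>\<close>, that is, evaluation at the \<open>x\<^bsub>\<pi>(i)\<^esub>\<close>.\<close>

definition var_map :: "(nat \<Rightarrow> nat) \<Rightarrow> 'k::field mpoly \<Rightarrow> 'k mpoly" where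
  "var_map \<pi> p =
    (\<Sum>t \<in> Poly_Mapping.keys p. scalar (Poly_Mapping.lookup p t) *
      (\<Prod>i \<in> Poly_Mapping.keys t. var (\<pi> i) ^ Poly_Mapping.lookup t i))"

text \<open>
  Note that \<^const>\<open>genideal\<close> is the intended generated ideal only for subsets of the carrier.
\<close>

lemma cring_poly_ring_in: "cring (poly_ring_in m :: 'k::field mpoly ring)"
proof -
  have times: "p * q \<in> carrier (poly_ring_in m)"
    if pq: "p \<in> carrier (poly_ring_in m)" "q \<in> carrier (poly_ring_in m)" for p q :: "'k mpoly"
  proof -
    have "Poly_Mapping.keys t \<subseteq> {1..m}" if t: "t \<in> Poly_Mapping.keys (p * q)" for t
    proof -
      obtain a b where "t = a + b" "a \<in> Poly_Mapping.keys p" "b \<in> Poly_Mapping.keys q"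
        using keys_mult[of p q] t by blast
      then show ?thesis
        using pq keys_add[of a b] unfolding poly_ring_in_def by fastforce
    qed
    then show ?thesis by (simp add: poly_ring_in_def)
  qed
  have plus: "p + q \<in> carrier (poly_ring_in m)"
    if pq: "p \<in> carrier (poly_ring_in m)" "q \<in> carrier (poly_ring_in m)" for p q :: "'k mpoly"
    using pq keys_add[of p q] by (fastforce simp: poly_ring_in_def)
  have uminus: "- p \<in> carrier (poly_ring_in m)"
    if "p \<in> carrier (poly_ring_in m)" for p :: "'k mpoly"
    using that by (simp add: poly_ring_in_def)
  show ?thesis
  proof (rule cringI)
    show "abelian_group (poly_ring_in m :: 'k mpoly ring)"
    proof (rule abelian_groupI)
      fix p :: "'k mpoly" assume "p \<in> carrier (poly_ring_in m)"
      then have "- p \<in> carrier (poly_ring_in m)" by (rule uminus)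
      then show "\<exists>q \<in> carrier (poly_ring_in m). q \<oplus>\<^bsub>poly_ring_in m\<^esub> p = \<zero>\<^bsub>poly_ring_in m\<^esub>"
        by (rule bexI[rotated]) (simp add: poly_ring_in_def)
    next
      fix p q :: "'k mpoly"
      assume "p \<in> carrier (poly_ring_in m)" "q \<in> carrier (poly_ring_in m)"
      then show "p \<oplus>\<^bsub>poly_ring_in m\<^esub> q \<in> carrier (poly_ring_in m)"
        using plus[of p q] by (simp add: poly_ring_in_def)
    qed (simp_all add: poly_ring_in_def ac_simps)
    show "comm_monoid (poly_ring_in m :: 'k mpoly ring)"
    proof (rule comm_monoidI)
      fix p q :: "'k mpoly"
      assume "p \<in> carrier (poly_ring_in m)" "q \<in> carrier (poly_ring_in m)"
      then show "p \<otimes>\<^bsub>poly_ring_in m\<^esub> q \<in> carrier (poly_ring_in m)"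
        using times[of p q] by (simp add: poly_ring_in_def)
    qed (simp_all add: poly_ring_in_def ac_simps)
  qed (simp add: poly_ring_in_def distrib_right)
qed

lemma var_in_poly_ring_in: "i \<in> {1..m} \<Longrightarrow> var i \<in> carrier (poly_ring_in m)"
  by (simp add: var_def poly_ring_in_def)


section \<open>Cohen--Macaulay quotients\<close>

text \<open>
  Suprema are taken in \<^typ>\<open>enat\<close>; by \<open>Sup {} = 0\<close> the zero ring has dimension and depth 0.
\<close>

definition krull_dim :: "('a, 'b) ring_scheme \<Rightarrow> enat" where
  "krull_dim A = Sup {enat l | l. \<exists>P. (\<forall>i\<le>l. primeideal (P i) A) \<and> (\<forall>i<l. P i \<subset> P (Suc i))}"

definition nonzerodivisor :: "('a, 'b) ring_scheme \<Rightarrow> 'a \<Rightarrow> bool" where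
  "nonzerodivisor A a \<longleftrightarrow>
    a \<in> carrier A \<and> (\<forall>b \<in> carrier A. a \<otimes>\<^bsub>A\<^esub> b = \<zero>\<^bsub>A\<^esub> \<longrightarrow> b = \<zero>\<^bsub>A\<^esub>)"

definition regular_sequence :: "('a, 'b) ring_scheme \<Rightarrow> 'a list \<Rightarrow> bool" where
  "regular_sequence A as \<longleftrightarrow>
    set as \<subseteq> carrier A \<and>
    (\<forall>i < length as. let J = genideal A (set (take i as))
       in nonzerodivisor (A Quot J) (J +>\<^bsub>A\<^esub> as ! i)) \<and>
    genideal A (set as) \<noteq> carrier A"

definition depth_at :: "'a set \<Rightarrow> ('a, 'b) ring_scheme \<Rightarrow> enat" where
  "depth_at M A = Sup {enat (length as) | as. set as \<subseteq> M \<and> regular_sequence A as}"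

definition irrelevant_ideal :: "nat \<Rightarrow> 'k::field mpoly set" where
  "irrelevant_ideal m = genideal (poly_ring_in m) (var ` {1..m})"

text \<open>
  The depth of the graded ring \<open>R\<^sub>m / I\<close> is taken with respect to its graded maximal ideal, the
  image of \<open>(x\<^sub>1, \<dots>, x\<^sub>m)\<close>.  This is the usual notion for homogeneous \<open>I\<close>, the only case intended.
\<close>

definition graded_depth :: "nat \<Rightarrow> 'k::field mpoly set \<Rightarrow> enat" where
  "graded_depth m I =
    depth_at ((\<lambda>f. I +>\<^bsub>poly_ring_in m\<^esub> f) ` irrelevant_ideal m) (poly_ring_in m Quot I)"

definition Cohen_Macaulay_ideal :: "nat \<Rightarrow> 'k::field mpoly set \<Rightarrow> bool" where
  "Cohen_Macaulay_ideal m I \<longleftrightarrow> graded_depth m I = krull_dim (poly_ring_in m Quot I)"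


section \<open>Edge ideals\<close>

text \<open>A simple graph on \<open>[n]\<close> is given by its edge set, a set of two-element subsets of \<open>{1..n}\<close>.\<close>

definition complement_edges :: "nat \<Rightarrow> nat set set \<Rightarrow> nat set set" where
  "complement_edges n E = {{i, j} | i j. i \<in> {1..n} \<and> j \<in> {1..n} \<and> i \<noteq> j} - E"

definition line_edges :: "nat \<Rightarrow> nat set set" where
  "line_edges n = {{i, i + 1} | i. 1 \<le> i \<and> i < n}"

definition edge_ideal :: "nat \<Rightarrow> nat set set \<Rightarrow> 'k::field mpoly set" where
  "edge_ideal n E = genideal (poly_ring_in n) {var i * var j | i j. {i, j} \<in> E}"


section \<open>The action of increasing maps\<close>

definition Inc :: "nat \<Rightarrow> nat \<Rightarrow> (nat \<Rightarrow> nat) set" where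
  "Inc n m = {\<pi> \<in> {1..n} \<rightarrow>\<^sub>E {1..m}. strict_mono_on {1..n} \<pi>}"

definition Inc_ideal :: "nat \<Rightarrow> nat \<Rightarrow> 'k::field mpoly set \<Rightarrow> 'k mpoly set" where
  "Inc_ideal n m I = genideal (poly_ring_in m) (\<Union>\<pi> \<in> Inc n m. var_map \<pi> ` I)"

end

theory Submission
  imports Defs
begin

text \<open>
  Put \<open>m = n + r\<close>.  An increasing map can only stretch the gap between the two ends of an edge, and
  for \<open>n \<ge> 3\<close> every pair \<open>a < b\<close> in \<open>[m]\<close> with \<open>b - a \<ge> 2\<close> is the image of an edge of the complement of
  the line.  So the ideal in question is the edge ideal of the complement of the line on \<open>[m]\<close>
  (\<open>Inc_ideal_eq_path_ideal\<close>), which is the Stanley--Reisner ideal of the path with facets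
  \<open>{i, i + 1}\<close>: a monomial is nonzero in the quotient \<open>A\<close> iff its variables lie in one facet.  The path
  is a connected complex of dimension 1, so \<open>A\<close> has depth 2 and dimension 2.  The proof is
  the sandwich \<open>2 \<le> depth A \<le> dim A \<le> 2\<close>.

  \<^item> \<open>2 \<le> depth A\<close> (\<open>regular_sequence_parity_sums\<close>): the sum of the odd variables and the sum of the
    even variables form a regular sequence.  On each facet they restrict to the two variables of the
    facet, so both act on coefficients as a shift.  Regularity of the second modulo the first is
    a gluing problem along the path, and it is solvable because the path is connected.

  \<^item> \<open>depth A \<le> dim A\<close> (\<open>depth_at_le_krull_dim\<close>) holds for every commutative ring: a nonzerodivisor
    contained in a prime lies outside some strictly smaller prime, so a regular sequence
    gives a chain of primes of the same length.

  \<^item> \<open>dim A \<le> 2\<close> (\<open>krull_dim_path_quotient_le\<close>): elements chosen from the successive differences of a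
    chain of four primes satisfy no nontrivial polynomial relation modulo the smallest prime
    (\<open>prime_chain_algebraically_independent\<close>).  But the monomials that survive in \<open>A\<close> with exponents
    up to \<open>D\<close> number only \<open>O(D\<^sup>2)\<close>, which forces a relation between any three elements
    (\<open>algebraic_relation_mod_path_ideal\<close>).
\<close>

section \<open>Depth is at most dimension\<close>

text \<open>
  By Zorn's lemma there is an ideal that is maximal among those that contain \<open>J\<close> and avoid \<open>S\<close>.
  It is prime: if it contained a product but neither factor, then enlarging it by either factor would
  make it meet \<open>S\<close>, and the product of the two elements of \<open>S\<close> so obtained would lie in the ideal itself.
\<close>

lemma (in cring) exists_primeideal_avoiding:
  assumes J: "ideal J R" and S: "S \<subseteq> carrier R" and one: "\<one> \<in> S"
    and mult: "\<And>x y. x \<in> S \<Longrightarrow> y \<in> S \<Longrightarrow> x \<otimes> y \<in> S" and disj: "J \<inter> S = {}"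
  obtains P where "primeideal P R" "J \<subseteq> P" "P \<inter> S = {}"
proof -
  define F where "F = {K. ideal K R \<and> J \<subseteq> K \<and> K \<inter> S = {}}"
  have "\<exists>M\<in>F. \<forall>K\<in>F. M \<subseteq> K \<longrightarrow> K = M"
  proof (rule subset_Zorn_nonempty)
    show "F \<noteq> {}" using J disj by (auto simp: F_def)
    fix C assume C: "C \<noteq> {}" "subset.chain F C"
    then have "subset.chain {I. ideal I R} C"
      by (auto simp: F_def subset_chain_def)
    then have "ideal (\<Union>C) R"
      using chain_Union_is_ideal[of C] C(1) by simp
    then show "\<Union>C \<in> F"
      using C by (fastforce simp: F_def subset_chain_def)
  qed
  then obtain M where M: "ideal M R" "J \<subseteq> M" "M \<inter> S = {}"
    and max: "\<And>K. ideal K R \<Longrightarrow> M \<subseteq> K \<Longrightarrow> K \<inter> S = {} \<Longrightarrow> K = M"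
    by (auto simp: F_def)
  interpret M: ideal M R by (rule M(1))
  have meet: "\<exists>p\<in>M. \<exists>r\<in>carrier R. p \<oplus> r \<otimes> a \<in> S" if a: "a \<in> carrier R" "a \<notin> M" for a
  proof -
    let ?K = "set_add R M (PIdl a)"
    have K: "ideal ?K R" using add_ideals[OF M(1) cgenideal_ideal[OF a(1)]] .
    have memK: "p \<oplus> r \<otimes> a \<in> ?K" if "p \<in> M" "r \<in> carrier R" for p r
      using that by (auto simp: set_add_def' cgenideal_def)
    have "M \<subseteq> ?K"
    proof
      fix x assume "x \<in> M"
      then show "x \<in> ?K" using memK[of x \<zero>] a(1) M.Icarr by simp
    qed
    moreover have "a \<in> ?K" using memK[of \<zero> \<one>] a(1) by simp
    ultimately have "?K \<inter> S \<noteq> {}" using max[OF K] a(2) by blast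
    then show ?thesis by (auto simp: set_add_def' cgenideal_def)
  qed
  have "primeideal M R"
  proof (rule primeidealI[OF M(1) is_cring])
    show "carrier R \<noteq> M" using M(3) one S by blast
    fix a b assume ab: "a \<in> carrier R" "b \<in> carrier R" "a \<otimes> b \<in> M"
    show "a \<in> M \<or> b \<in> M"
    proof (rule ccontr)
      assume "\<not> (a \<in> M \<or> b \<in> M)"
      then obtain p r q s where pr: "p \<in> M" "r \<in> carrier R" "p \<oplus> r \<otimes> a \<in> S"
        and qs: "q \<in> M" "s \<in> carrier R" "q \<oplus> s \<otimes> b \<in> S"
        using meet ab by meson
      have carr: "p \<in> carrier R" "q \<in> carrier R" using pr qs M.Icarr by auto
      have "(p \<oplus> r \<otimes> a) \<otimes> (q \<oplus> s \<otimes> b) =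
          p \<otimes> (q \<oplus> s \<otimes> b) \<oplus> ((r \<otimes> a) \<otimes> q \<oplus> (r \<otimes> s) \<otimes> (a \<otimes> b))"
        using carr pr(2) qs(2) ab(1,2) by algebra
      also have "\<dots> \<in> M"
        using M.I_r_closed[OF pr(1), of "q \<oplus> s \<otimes> b"] M.I_l_closed[OF qs(1), of "r \<otimes> a"]
          M.I_l_closed[OF ab(3), of "r \<otimes> s"] carr pr(2) qs(2) ab(1,2) by simp
      finally show False using mult[OF pr(3) qs(3)] M(3) by blast
    qed
  qed
  with M that show thesis by blast
qed

text \<open>
  The multiplicative set of all \<open>s a\<^sup>n\<close> with \<open>s \<notin> Q\<close> avoids \<open>J\<close>, since powers of \<open>a\<close> can be
  cancelled modulo \<open>J\<close>.  A prime avoiding it is contained in \<open>Q\<close> (take \<open>n = 0\<close>) and misses \<open>a\<close>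
  (take \<open>s = 1\<close>).
\<close>

lemma (in cring) primeideal_below_nonzerodivisor:
  assumes J: "ideal J R" and Q: "primeideal Q R" "J \<subseteq> Q" and a: "a \<in> Q"
    and nzd: "\<And>b. b \<in> carrier R \<Longrightarrow> a \<otimes> b \<in> J \<Longrightarrow> b \<in> J"
  obtains P where "primeideal P R" "J \<subseteq> P" "P \<subset> Q"
proof -
  interpret Q: primeideal Q R by (rule Q(1))
  have ac: "a \<in> carrier R" using a Q.Icarr by simp
  define S where "S = {s \<otimes> a [^] n | s n. s \<in> carrier R - Q \<and> (n::nat) \<in> UNIV}"
  have one: "\<one> \<notin> Q" using Q.one_imp_carrier Q.I_notcarr by blast
  have cancel: "s \<in> J" if "s \<in> carrier R" "s \<otimes> a [^] n \<in> J" for s and n :: nat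
    using that
  proof (induction n)
    case (Suc n)
    have "a \<otimes> (s \<otimes> a [^] n) = s \<otimes> a [^] Suc n"
      using Suc.prems(1) ac by (simp add: m_ac)
    then show ?case using nzd[of "s \<otimes> a [^] n"] Suc ac by simp
  qed simp
  obtain P where P: "primeideal P R" "J \<subseteq> P" "P \<inter> S = {}"
  proof (rule exists_primeideal_avoiding[OF J])
    show "S \<subseteq> carrier R" using ac by (auto simp: S_def)
    show "\<one> \<in> S" unfolding S_def using one
      by (intro CollectI exI[of _ "\<one>"] exI[of _ "0::nat"]) simp
    show "J \<inter> S = {}" using cancel Q(2) by (auto simp: S_def)
    fix x y assume "x \<in> S" "y \<in> S"
    then obtain s n t k where st: "s \<in> carrier R - Q" "t \<in> carrier R - Q"
      and xy: "x = s \<otimes> a [^] (n::nat)" "y = t \<otimes> a [^] (k::nat)"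
      unfolding S_def by auto
    have "x \<otimes> y = (s \<otimes> t) \<otimes> a [^] (n + k)"
      unfolding xy using st ac by (simp add: nat_pow_mult[symmetric] m_ac)
    moreover have "s \<otimes> t \<in> carrier R - Q" using st Q.I_prime by auto
    ultimately show "x \<otimes> y \<in> S" unfolding S_def by blast
  qed (use that in blast)
  have "P \<subseteq> Q"
  proof
    fix x assume "x \<in> P"
    show "x \<in> Q"
    proof (rule ccontr)
      assume "x \<notin> Q"
      moreover have xc: "x \<in> carrier R" using \<open>x \<in> P\<close> P(1) ideal.Icarr primeideal.axioms(1) by metis
      ultimately have "x \<otimes> a [^] (0::nat) \<in> S" unfolding S_def by blast
      then show False using P(3) \<open>x \<in> P\<close> xc by auto
    qed
  qed
  moreover have "\<one> \<otimes> a [^] (1::nat) \<in> S" unfolding S_def using one by blast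
  then have "a \<notin> P" using P(3) ac by auto
  ultimately show thesis using P that a by blast
qed

lemma (in cring) mem_ideal_iff_coset_eq:
  assumes "ideal J R" "a \<in> carrier R"
  shows "J +> a = J \<longleftrightarrow> a \<in> J"
  using assms ideal.rcos_const_imp_mem a_rcos_zero by metis

lemma (in ideal) carrier_quotient: "carrier (R Quot I) = ((+>) I) ` carrier R"
  by (auto simp: FactRing_def A_RCOSETS_def')

lemma (in cring) nonzerodivisor_quotient_iff:
  assumes J: "ideal J R" and a: "a \<in> carrier R"
  shows "nonzerodivisor (R Quot J) (J +> a) \<longleftrightarrow>
    (\<forall>b\<in>carrier R. a \<otimes> b \<in> J \<longrightarrow> b \<in> J)"
proof -
  have "(J +> a) \<otimes>\<^bsub>R Quot J\<^esub> (J +> b) = J +> (a \<otimes> b)" if "b \<in> carrier R" for b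
    using ideal.rcoset_mult_add[OF J a that] by (simp add: FactRing_def)
  moreover have "\<zero>\<^bsub>R Quot J\<^esub> = J" by (simp add: FactRing_def)
  ultimately show ?thesis
    unfolding nonzerodivisor_def ideal.carrier_quotient[OF J]
    using mem_ideal_iff_coset_eq[OF J] a by auto
qed

text \<open>
  Starting from a prime that contains all entries, \<open>primeideal_below_nonzerodivisor\<close> supplies a
  smaller prime for each entry, from the last to the first.  Working with the ideals generated by initial segments inside
  the one ring \<open>R\<close> avoids passing to iterated quotients.
\<close>

lemma (in cring) regular_sequence_length_le_krull_dim:
  assumes "regular_sequence R as"
  shows "enat (length as) \<le> krull_dim R"
proof -
  define J where "J i = Idl (set (take i as))" for i
  have carr: "set as \<subseteq> carrier R" using assms by (simp add: regular_sequence_def)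
  have J: "ideal (J i) R" for i
    unfolding J_def using carr set_take_subset[of i as] by (intro genideal_ideal) blast
  have nzd: "b \<in> J i" if "i < length as" "b \<in> carrier R" "as ! i \<otimes> b \<in> J i" for i b
  proof -
    have "nonzerodivisor (R Quot J i) (J i +> as ! i)"
      using assms that(1) by (simp add: regular_sequence_def J_def Let_def)
    moreover have "as ! i \<in> carrier R" using carr that(1) by auto
    ultimately show ?thesis using nonzerodivisor_quotient_iff[OF J] that by simp
  qed
  have step: "J i \<subseteq> J (Suc i) \<and> as ! i \<in> J (Suc i)" if "i < length as" for i
  proof -
    have "set (take (Suc i) as) \<subseteq> J (Suc i)"
      unfolding J_def using carr set_take_subset[of "Suc i" as] by (intro genideal_self) blast
    moreover have "set (take (Suc i) as) = insert (as ! i) (set (take i as))"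
      using that by (simp add: take_Suc_conv_app_nth)
    ultimately show ?thesis
      using genideal_minimal[OF J, of "set (take i as)" "Suc i"] unfolding J_def by blast
  qed
  (* The least prime of a chain of length k still contains the first length as - k entries. *)
  have "\<exists>P. (\<forall>i\<le>k. primeideal (P i) R) \<and> (\<forall>i<k. P i \<subset> P (Suc i)) \<and> J (length as - k) \<subseteq> P 0"
    if "k \<le> length as" for k
    using that
  proof (induction k)
    case 0
    have "\<one> \<notin> J (length as)"
      using assms ideal.one_imp_carrier[OF J, of "length as"]
      by (auto simp: regular_sequence_def J_def)
    then obtain Q where "primeideal Q R" "J (length as) \<subseteq> Q"
      using exists_primeideal_avoiding[OF J, of "{\<one>}" "length as"] by auto
    then show ?case by (intro exI[of _ "\<lambda>_. Q"]) simp
  next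
    case (Suc k)
    then obtain P where P: "\<forall>i\<le>k. primeideal (P i) R" "\<forall>i<k. P i \<subset> P (Suc i)"
        "J (length as - k) \<subseteq> P 0"
      by auto
    define i where "i = length as - Suc k"
    have i: "i < length as" "length as - k = Suc i" using Suc.prems by (auto simp: i_def)
    have P0: "primeideal (P 0) R" "J i \<subseteq> P 0" "as ! i \<in> P 0"
      using P(1,3) i step[OF i(1)] by auto
    obtain Q where Q: "primeideal Q R" "J i \<subseteq> Q" "Q \<subset> P 0"
    proof (rule primeideal_below_nonzerodivisor[OF J P0])
      show "b \<in> J i" if "b \<in> carrier R" "as ! i \<otimes> b \<in> J i" for b
        using nzd[OF i(1) that] .
    qed
    show ?case
    proof (intro exI[of _ "case_nat Q P"] conjI allI impI)
      fix j assume "j \<le> Suc k"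
      then show "primeideal (case_nat Q P j) R" using Q P by (auto split: nat.split)
    next
      fix j assume "j < Suc k"
      then show "case_nat Q P j \<subset> case_nat Q P (Suc j)" using Q P by (auto split: nat.split)
    qed (use Q i in \<open>simp add: i_def\<close>)
  qed
  from this[of "length as"] show ?thesis
    unfolding krull_dim_def by (intro Sup_upper) auto
qed

lemma (in cring) depth_at_le_krull_dim: "depth_at M R \<le> krull_dim R"
  unfolding depth_at_def using regular_sequence_length_le_krull_dim by (intro Sup_least) auto

lemma (in cring) genideal_empty: "Idl {} = {\<zero>}"
  using genideal_minimal[OF zeroideal, of "{}"]
    additive_subgroup.zero_closed[OF ideal.axioms(1)[OF genideal_ideal[of "{}"]]] by auto

lemma (in cring) regular_sequence_pairI:
  assumes ab: "a \<in> carrier R" "b \<in> carrier R"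
    and a_reg: "\<And>x. x \<in> carrier R \<Longrightarrow> a \<otimes> x = \<zero> \<Longrightarrow> x = \<zero>"
    and b_reg: "\<And>x. x \<in> carrier R \<Longrightarrow> b \<otimes> x \<in> PIdl a \<Longrightarrow> x \<in> PIdl a"
    and proper: "Idl {a, b} \<noteq> carrier R"
  shows "regular_sequence R [a, b]"
proof -
  have "nonzerodivisor (R Quot Idl {}) (Idl {} +> a)"
    using a_reg nonzerodivisor_quotient_iff[OF zeroideal ab(1)] by (simp add: genideal_empty)
  moreover have "nonzerodivisor (R Quot Idl {a}) (Idl {a} +> b)"
    using b_reg nonzerodivisor_quotient_iff[OF cgenideal_ideal[OF ab(1)] ab(2)]
    by (simp add: cgenideal_eq_genideal[OF ab(1)])
  ultimately show ?thesis
    using ab proper by (auto simp: regular_sequence_def Let_def less_Suc_eq)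
qed


section \<open>Arithmetic and ideals of the polynomial rings\<close>

lemma poly_ring_in_simps [simp]:
  "x \<otimes>\<^bsub>poly_ring_in m\<^esub> y = x * y" "x \<oplus>\<^bsub>poly_ring_in m\<^esub> y = x + y"
  "\<zero>\<^bsub>poly_ring_in m\<^esub> = 0" "\<one>\<^bsub>poly_ring_in m\<^esub> = 1"
  by (simp_all add: poly_ring_in_def)

lemma mem_poly_ring_in_iff:
  "p \<in> carrier (poly_ring_in m) \<longleftrightarrow> (\<forall>t\<in>Poly_Mapping.keys p. Poly_Mapping.keys t \<subseteq> {1..m})"
  by (simp add: poly_ring_in_def)

lemma poly_ring_in_closed:
  fixes p q :: "'k::field mpoly"
  assumes "p \<in> carrier (poly_ring_in m)" "q \<in> carrier (poly_ring_in m)"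
  shows "p + q \<in> carrier (poly_ring_in m)" "p * q \<in> carrier (poly_ring_in m)"
    "- p \<in> carrier (poly_ring_in m)" "p - q \<in> carrier (poly_ring_in m)"
proof -
  interpret cring "poly_ring_in m :: 'k mpoly ring" by (rule cring_poly_ring_in)
  show "p + q \<in> carrier (poly_ring_in m)" "p * q \<in> carrier (poly_ring_in m)"
    using a_closed[OF assms] m_closed[OF assms] by simp_all
  have uminus: "- r \<in> carrier (poly_ring_in m)" if "r \<in> carrier (poly_ring_in m)" for r :: "'k mpoly"
    using that by (simp add: mem_poly_ring_in_iff)
  show "- p \<in> carrier (poly_ring_in m)" by (rule uminus[OF assms(1)])
  show "p - q \<in> carrier (poly_ring_in m)"
    using a_closed[OF assms(1) uminus[OF assms(2)]] by simp
qed

lemma one_in_poly_ring_in: "1 \<in> carrier (poly_ring_in m)"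
  by (simp add: mem_poly_ring_in_iff flip: single_one)

lemma scalar_in_poly_ring_in: "scalar c \<in> carrier (poly_ring_in m)"
  by (simp add: mem_poly_ring_in_iff scalar_def)

lemma sum_in_poly_ring_in:
  "(\<And>x. x \<in> A \<Longrightarrow> f x \<in> carrier (poly_ring_in m)) \<Longrightarrow> sum f A \<in> carrier (poly_ring_in m)"
  by (induction A rule: infinite_finite_induct)
    (auto simp: poly_ring_in_closed mem_poly_ring_in_iff[of 0])

lemma power_in_poly_ring_in:
  "p \<in> carrier (poly_ring_in m) \<Longrightarrow> p ^ n \<in> carrier (poly_ring_in m)"
  by (induction n) (auto simp: poly_ring_in_closed one_in_poly_ring_in)

lemma a_inv_poly_ring_in:
  assumes "(p :: 'k::field mpoly) \<in> carrier (poly_ring_in m)"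
  shows "a_inv (poly_ring_in m) p = - p"
proof -
  interpret cring "poly_ring_in m :: 'k mpoly ring" by (rule cring_poly_ring_in)
  show ?thesis using minus_equality[of "- p" p] assms poly_ring_in_closed[OF assms assms] by simp
qed

text \<open>
  The type of polynomials is itself a commutative ring, of which \<open>poly_ring_in m\<close> is a subring.  This
  lemma and the next let ideals be handled with the operations of the type.
\<close>

lemma ideal_poly_ring_inI:
  fixes I :: "'k::field mpoly set"
  assumes "I \<subseteq> carrier (poly_ring_in m)" "0 \<in> I"
    and plus: "\<And>p q. p \<in> I \<Longrightarrow> q \<in> I \<Longrightarrow> p + q \<in> I"
    and times: "\<And>p q. p \<in> I \<Longrightarrow> q \<in> carrier (poly_ring_in m) \<Longrightarrow> q * p \<in> I"
  shows "ideal I (poly_ring_in m)"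
proof -
  interpret cring "poly_ring_in m :: 'k mpoly ring" by (rule cring_poly_ring_in)
  have minus: "- p \<in> I" if "p \<in> I" for p
    using times[OF that poly_ring_in_closed(3)[OF one_in_poly_ring_in one_in_poly_ring_in]] by simp
  show ?thesis
  proof (rule idealI[OF ring_axioms])
    show "subgroup I (add_monoid (poly_ring_in m))"
    proof (rule add.subgroupI)
      show "a_inv (poly_ring_in m) p \<in> I" if "p \<in> I" for p
        using minus[OF that] a_inv_poly_ring_in[of p m] subsetD[OF assms(1) that] by simp
      show "I \<subseteq> carrier (poly_ring_in m)" by (rule assms(1))
      show "I \<noteq> {}" using assms(2) by blast
      show "p \<oplus>\<^bsub>poly_ring_in m\<^esub> q \<in> I" if "p \<in> I" "q \<in> I" for p q
        using plus[OF that] by simp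
    qed
  qed (use times in \<open>simp_all add: mult.commute\<close>)
qed

lemma ideal_poly_ring_inD:
  fixes I :: "'k::field mpoly set"
  assumes "ideal I (poly_ring_in m)"
  shows "0 \<in> I" "p \<in> I \<Longrightarrow> q \<in> I \<Longrightarrow> p + q \<in> I" "p \<in> I \<Longrightarrow> q \<in> I \<Longrightarrow> p - q \<in> I"
    "p \<in> I \<Longrightarrow> q \<in> carrier (poly_ring_in m) \<Longrightarrow> q * p \<in> I"
    "p \<in> I \<Longrightarrow> p \<in> carrier (poly_ring_in m)"
proof -
  interpret ideal I "poly_ring_in m" by fact
  show "0 \<in> I" using additive_subgroup.zero_closed[OF is_additive_subgroup] by simp
  show "p + q \<in> I" if "p \<in> I" "q \<in> I" using additive_subgroup.a_closed[OF is_additive_subgroup that] by simp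
  show "q * p \<in> I" if "p \<in> I" "q \<in> carrier (poly_ring_in m)"
    using I_l_closed[OF that] by simp
  show "p \<in> carrier (poly_ring_in m)" if "p \<in> I" using that by (rule Icarr)
  have "- 1 * q \<in> I" if "q \<in> I"
    using I_l_closed[OF that poly_ring_in_closed(3)[OF one_in_poly_ring_in one_in_poly_ring_in]] by simp
  then show "p - q \<in> I" if "p \<in> I" "q \<in> I"
    using additive_subgroup.a_closed[OF is_additive_subgroup that(1), of "- 1 * q"] that(2) by simp
qed

lemma lookup_single_times:
  fixes f :: "('a::cancel_comm_monoid_add) \<Rightarrow>\<^sub>0 'k::comm_semiring_1"
  shows "Poly_Mapping.lookup (Poly_Mapping.single e c * f) (e + s) = c * Poly_Mapping.lookup f s"
proof -
  have "Poly_Mapping.lookup (Poly_Mapping.single e c * f) (e + s)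
      = (\<Sum>l. c * (\<Sum>q. Poly_Mapping.lookup f q when e + s = l + q) when e = l)"
    by (simp add: lookup_mult lookup_single when_mult)
  also have "\<dots> = c * (\<Sum>q. Poly_Mapping.lookup f q when s = q)"
    by (simp add: Sum_any_when_equal')
  finally show ?thesis by simp
qed

lemma keys_var_times:
  fixes f :: "'k::field mpoly"
  assumes "t \<in> Poly_Mapping.keys (var i * f)" shows "i \<in> Poly_Mapping.keys t"
proof -
  obtain s where "t = Poly_Mapping.single i 1 + s"
    using keys_mult[of "var i" f] assms by (auto simp: var_def)
  then show ?thesis by (simp add: in_keys_iff lookup_add)
qed

lemma poly_mapping_sum_single:
  "p = (\<Sum>t\<in>Poly_Mapping.keys p. Poly_Mapping.single t (Poly_Mapping.lookup p t))"
  by (rule poly_mapping_eqI) (auto simp: lookup_sum lookup_single when_def in_keys_iff)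

lemma a_minus_poly_ring_in:
  fixes p q :: "'k::field mpoly"
  assumes "q \<in> carrier (poly_ring_in m)"
  shows "p \<ominus>\<^bsub>poly_ring_in m\<^esub> q = p - q"
  using a_inv_poly_ring_in[OF assms] by (simp add: a_minus_def)


section \<open>The Stanley--Reisner ideal of a path\<close>

text \<open>
  For the support of a monomial, to be a face of the path complex means to be contained in some
  \<open>{i, i + 1}\<close>; equivalently, no two of its variables are at distance 2 or more.
\<close>

definition face :: "(nat \<Rightarrow>\<^sub>0 nat) \<Rightarrow> bool" where
  "face t \<longleftrightarrow> (\<forall>i\<in>Poly_Mapping.keys t. \<forall>j\<in>Poly_Mapping.keys t. j \<le> i + 1)"

text \<open>
  This is the edge ideal of the complement of the line on \<open>[m]\<close>, described by its monomials rather
  than by its generators: membership becomes a condition on single coefficients.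
\<close>

definition path_ideal :: "nat \<Rightarrow> 'k::field mpoly set" where
  "path_ideal m = {p \<in> carrier (poly_ring_in m). \<forall>t\<in>Poly_Mapping.keys p. \<not> face t}"

lemma keys_plus_nat: "Poly_Mapping.keys (s + t :: nat \<Rightarrow>\<^sub>0 nat) = Poly_Mapping.keys s \<union> Poly_Mapping.keys t"
  by (auto simp: in_keys_iff lookup_add)

lemma face_mono: "face (s + t) \<Longrightarrow> face t"
  by (auto simp: face_def keys_plus_nat)

lemma ideal_path_ideal: "ideal (path_ideal m :: 'k::field mpoly set) (poly_ring_in m)"
proof (rule ideal_poly_ring_inI)
  fix p q :: "'k mpoly" assume p: "p \<in> path_ideal m"
  show "p + q \<in> path_ideal m" if "q \<in> path_ideal m"
    using p that poly_ring_in_closed[of p m q] keys_add[of p q] by (auto simp: path_ideal_def)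
  show "q * p \<in> path_ideal m" if q: "q \<in> carrier (poly_ring_in m)"
  proof -
    have "\<not> face t" if "t \<in> Poly_Mapping.keys (q * p)" for t
    proof -
      obtain a b where "t = a + b" "b \<in> Poly_Mapping.keys p"
        using keys_mult[of q p] \<open>t \<in> _\<close> by blast
      then show ?thesis using p face_mono[of a b] by (auto simp: path_ideal_def)
    qed
    then show ?thesis using p q poly_ring_in_closed[of q m p] by (auto simp: path_ideal_def)
  qed
qed (auto simp: path_ideal_def mem_poly_ring_in_iff)

text \<open>
  Together with the fact that the quadrics \<open>x\<^sub>a x\<^sub>b\<close> with \<open>a + 1 < b\<close> lie in \<open>path_ideal m\<close>, this says
  that they generate it: a monomial whose support is not a face is divisible by one of them.
\<close>

lemma path_ideal_minimal:
  fixes I :: "'k::field mpoly set"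
  assumes I: "ideal I (poly_ring_in m)"
    and gen: "\<And>a b. 1 \<le> a \<Longrightarrow> a + 1 < b \<Longrightarrow> b \<le> m \<Longrightarrow> var a * var b \<in> I"
  shows "path_ideal m \<subseteq> I"
proof
  fix p :: "'k mpoly" assume p: "p \<in> path_ideal m"
  have mono: "Poly_Mapping.single t c \<in> I" if t: "t \<in> Poly_Mapping.keys p" for t and c :: 'k
  proof -
    have "\<not> face t" and tm: "Poly_Mapping.keys t \<subseteq> {1..m}"
      using p t by (auto simp: path_ideal_def mem_poly_ring_in_iff)
    then obtain a b where ab: "a \<in> Poly_Mapping.keys t" "b \<in> Poly_Mapping.keys t" "a + 1 < b"
      by (auto simp: face_def not_le)
    define e where "e = (Poly_Mapping.single a 1 + Poly_Mapping.single b 1 :: nat \<Rightarrow>\<^sub>0 nat)"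
    have t_eq: "t = (t - e) + e"
    proof (rule poly_mapping_eqI)
      fix k
      have "Poly_Mapping.lookup e k \<le> Poly_Mapping.lookup t k"
        using ab by (auto simp: e_def lookup_add lookup_single when_def in_keys_iff)
      then show "Poly_Mapping.lookup t k = Poly_Mapping.lookup (t - e + e) k"
        by (simp add: lookup_add lookup_minus)
    qed
    have "Poly_Mapping.single t c = Poly_Mapping.single (t - e) c * (var a * var b)"
      by (subst t_eq) (simp add: var_def mult_single e_def)
    moreover have "Poly_Mapping.single (t - e) c \<in> carrier (poly_ring_in m)"
    proof -
      have "Poly_Mapping.keys (t - e) \<subseteq> Poly_Mapping.keys t"
        using keys_plus_nat[of "t - e" e] t_eq by simp
      then show ?thesis using tm by (auto simp: mem_poly_ring_in_iff)
    qed
    moreover have "var a * var b \<in> I"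
      using gen[of a b] ab(3) subsetD[OF tm ab(1)] subsetD[OF tm ab(2)] by simp
    ultimately show ?thesis using ideal_poly_ring_inD(4)[OF I] by metis
  qed
  have "(\<Sum>t\<in>T. Poly_Mapping.single t (Poly_Mapping.lookup p t)) \<in> I" if "T \<subseteq> Poly_Mapping.keys p" for T
    using finite_subset[OF that finite_keys] that
    by (induction T rule: finite_induct) (auto intro: ideal_poly_ring_inD[OF I] mono)
  then show "p \<in> I" using poly_mapping_sum_single[of p] by (metis order_refl)
qed


section \<open>The ideal generated by the images of the edge ideal\<close>

lemma prod_in_poly_ring_in:
  "(\<And>x. x \<in> A \<Longrightarrow> f x \<in> carrier (poly_ring_in m)) \<Longrightarrow> prod f A \<in> carrier (poly_ring_in m)"
  by (induction A rule: infinite_finite_induct)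
    (auto simp: poly_ring_in_closed one_in_poly_ring_in)

lemma var_times_var: "var a * var b = Poly_Mapping.single (Poly_Mapping.single a 1 + Poly_Mapping.single b 1) 1"
  by (simp add: var_def mult_single)

lemma var_times_var_in_path_ideal:
  assumes "1 \<le> a" "a + 1 < b" "b \<le> m"
  shows "(var a * var b :: 'k::field mpoly) \<in> path_ideal m"
  unfolding path_ideal_def mem_Collect_eq
proof
  show "(var a * var b :: 'k mpoly) \<in> carrier (poly_ring_in m)"
    using assms by (intro poly_ring_in_closed var_in_poly_ring_in) auto
  have "\<not> face (Poly_Mapping.single a 1 + Poly_Mapping.single b 1)"
    using assms by (auto simp: face_def keys_plus_nat)
  then show "\<forall>t\<in>Poly_Mapping.keys (var a * var b :: 'k mpoly). \<not> face t"
    by (simp add: var_times_var)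
qed

lemma var_map_var_times_var:
  assumes "i \<noteq> j"
  shows "var_map \<pi> (var i * var j) = (var (\<pi> i) * var (\<pi> j) :: 'k::field mpoly)"
  using assms
  by (simp add: var_map_def var_times_var keys_plus_nat lookup_add lookup_single scalar_def mult_single add.commute)

text \<open>
  A monomial divisible by \<open>x\<^sub>a x\<^sub>b\<close> with \<open>b - a \<ge> 2\<close> goes to one divisible by \<open>x\<^bsub>\<pi>(a)\<^esub> x\<^bsub>\<pi>(b)\<^esub>\<close>, and
  \<open>\<pi>(b) - \<pi>(a) \<ge> 2\<close> because \<open>\<pi>(a + 1)\<close> lies strictly in between.
\<close>

lemma var_map_path_ideal:
  fixes p :: "'k::field mpoly"
  assumes p: "p \<in> path_ideal n" and \<pi>: "\<pi> \<in> Inc n m"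
  shows "var_map \<pi> p \<in> path_ideal m"
proof -
  note PD = ideal_poly_ring_inD[OF ideal_path_ideal[of m]]
  have range: "\<pi> i \<in> {1..m}" if "i \<in> {1..n}" for i using \<pi> that by (auto simp: Inc_def)
  have mono: "\<pi> i < \<pi> j" if "i \<in> {1..n}" "j \<in> {1..n}" "i < j" for i j
    using \<pi> that unfolding Inc_def strict_mono_on_def by blast
  have summand: "scalar c * (\<Prod>i\<in>Poly_Mapping.keys t. var (\<pi> i) ^ Poly_Mapping.lookup t i) \<in> path_ideal m"
    if t: "t \<in> Poly_Mapping.keys p" for t and c :: 'k
  proof -
    have tn: "Poly_Mapping.keys t \<subseteq> {1..n}" and "\<not> face t"
      using p t by (auto simp: path_ideal_def mem_poly_ring_in_iff)
    then obtain a b where ab: "a \<in> Poly_Mapping.keys t" "b \<in> Poly_Mapping.keys t" "a + 1 < b"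
      by (auto simp: face_def not_le)
    have abn: "a \<in> {1..n}" "b \<in> {1..n}" using ab tn by blast+
    let ?f = "\<lambda>i. (var (\<pi> i) :: 'k mpoly) ^ Poly_Mapping.lookup t i"
    let ?R = "Poly_Mapping.keys t - {a, b}"
    have factor: "?f i = var (\<pi> i) ^ (Poly_Mapping.lookup t i - 1) * var (\<pi> i)"
      if "i \<in> Poly_Mapping.keys t" for i
      using that by (cases "Poly_Mapping.lookup t i") (auto simp: in_keys_iff)
    have "prod ?f (Poly_Mapping.keys t) = ?f a * (?f b * prod ?f ?R)"
    proof -
      have "Poly_Mapping.keys t = insert a (insert b ?R)" using ab by blast
      then have "prod ?f (Poly_Mapping.keys t) = prod ?f (insert a (insert b ?R))" by simp
      also have "\<dots> = ?f a * (?f b * prod ?f ?R)" using ab(3) by (subst prod.insert) auto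
      finally show ?thesis .
    qed
    also have "\<dots> = (var (\<pi> a) ^ (Poly_Mapping.lookup t a - 1) *
        (var (\<pi> b) ^ (Poly_Mapping.lookup t b - 1) * prod ?f ?R)) * (var (\<pi> a) * var (\<pi> b))"
      by (simp only: factor[OF ab(1)] factor[OF ab(2)] ac_simps)
    finally have "prod ?f (Poly_Mapping.keys t) = \<dots>" .
    moreover have "var (\<pi> a) * var (\<pi> b) \<in> (path_ideal m :: 'k mpoly set)"
    proof (rule var_times_var_in_path_ideal)
      have "\<pi> a < \<pi> (a + 1)" "\<pi> (a + 1) < \<pi> b" using mono ab(3) abn by auto
      then show "\<pi> a + 1 < \<pi> b" by linarith
    qed (use range abn in auto)
    moreover have "var (\<pi> a) ^ (Poly_Mapping.lookup t a - 1) *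
        (var (\<pi> b) ^ (Poly_Mapping.lookup t b - 1) * prod ?f ?R) \<in> carrier (poly_ring_in m)"
      using range abn tn
      by (intro poly_ring_in_closed power_in_poly_ring_in prod_in_poly_ring_in var_in_poly_ring_in) blast+
    ultimately have "prod ?f (Poly_Mapping.keys t) \<in> path_ideal m" using PD(4) by simp
    then show ?thesis using PD(4) scalar_in_poly_ring_in by blast
  qed
  have "(\<Sum>t\<in>T. scalar (Poly_Mapping.lookup p t) *
      (\<Prod>i\<in>Poly_Mapping.keys t. var (\<pi> i) ^ Poly_Mapping.lookup t i)) \<in> path_ideal m"
    if "T \<subseteq> Poly_Mapping.keys p" for T
    using finite_subset[OF that finite_keys] that
    by (induction T rule: finite_induct) (auto intro: PD summand)
  then show ?thesis by (simp add: var_map_def)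
qed

lemma edge_ideal_complement_line_subset:
  "(edge_ideal n (complement_edges n (line_edges n)) :: 'k::field mpoly set) \<subseteq> path_ideal n"
proof -
  interpret R: cring "poly_ring_in n :: 'k mpoly ring" by (rule cring_poly_ring_in)
  have less: "(var i * var j :: 'k mpoly) \<in> path_ideal n"
    if "i \<in> {1..n}" "j \<in> {1..n}" "i < j" "{i, j} \<notin> line_edges n" for i j
  proof (rule var_times_var_in_path_ideal)
    have "j \<noteq> i + 1" using that by (auto simp: line_edges_def)
    then show "i + 1 < j" using that by simp
  qed (use that in auto)
  have "(var i * var j :: 'k mpoly) \<in> path_ideal n"
    if ij: "{i, j} \<in> complement_edges n (line_edges n)" for i j
  proof -
    have "i \<in> {1..n}" "j \<in> {1..n}" "i \<noteq> j" "{i, j} \<notin> line_edges n"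
      using ij by (auto simp: complement_edges_def doubleton_eq_iff)
    then show ?thesis
      using less[of i j] less[of j i] by (cases i j rule: linorder_cases) (simp_all add: insert_commute mult.commute)
  qed
  then show ?thesis
    unfolding edge_ideal_def by (intro R.genideal_minimal ideal_path_ideal) blast
qed

text \<open>
  Mapping \<open>i\<close> to \<open>a\<close> and \<open>j\<close> to \<open>b\<close> by an increasing map is possible as soon as there is enough room to
  the left of \<open>a\<close>, between \<open>a\<close> and \<open>b\<close>, and to the right of \<open>b\<close>.  An increasing map from \<open>[n]\<close> to
  \<open>[n + r]\<close> moves each point up by at most \<open>r\<close>; so \<open>i\<close> is chosen least with \<open>a - i \<le> r\<close>, and then \<open>j\<close> least
  with \<open>b - j \<le> r\<close> and \<open>j - i \<ge> 2\<close>.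
\<close>

lemma exists_Inc_edge:
  assumes n: "n \<ge> 3" and ab: "1 \<le> a" "a + 1 < b" "b \<le> n + r"
  obtains \<pi> i j where "\<pi> \<in> Inc n (n + r)" "1 \<le> i" "i + 1 < j" "j \<le> n" "\<pi> i = a" "\<pi> j = b"
proof -
  define i where "i = max 1 (a - r)"
  define j where "j = max (i + 2) (b - r)"
  have i: "1 \<le> i" "i \<le> a" "a \<le> i + r" "i \<le> n - 2" using n ab by (auto simp: i_def)
  have j: "i + 1 < j" "j \<le> n" "j \<le> b" "b \<le> j + r" "a + (j - i) \<le> b"
    using n ab i by (auto simp: j_def)
  define \<pi> where "\<pi> k = (if k \<notin> {1..n} then undefined
    else if k < i then k else if k < j then a + (k - i) else b + (k - j))" for k
  have "\<pi> \<in> Inc n (n + r)"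
    unfolding Inc_def mem_Collect_eq
  proof
    show "\<pi> \<in> {1..n} \<rightarrow>\<^sub>E {1..n + r}"
      using i j ab by (auto simp: \<pi>_def)
    show "strict_mono_on {1..n} \<pi>"
      using i j by (intro strict_mono_onI) (auto simp: \<pi>_def)
  qed
  moreover have "\<pi> i = a" "\<pi> j = b" using i j by (auto simp: \<pi>_def)
  ultimately show thesis using that i j by blast
qed

lemma Inc_ideal_eq_path_ideal:
  assumes n: "n \<ge> 3"
  shows "Inc_ideal n (n + r) (edge_ideal n (complement_edges n (line_edges n)))
    = (path_ideal (n + r) :: 'k::field mpoly set)"
proof
  interpret R: cring "poly_ring_in n :: 'k mpoly ring" by (rule cring_poly_ring_in)
  interpret S: cring "poly_ring_in (n + r) :: 'k mpoly ring" by (rule cring_poly_ring_in)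
  let ?I = "edge_ideal n (complement_edges n (line_edges n)) :: 'k mpoly set"
  let ?G = "\<Union>\<pi>\<in>Inc n (n + r). var_map \<pi> ` ?I"
  have G: "?G \<subseteq> path_ideal (n + r)"
    using var_map_path_ideal edge_ideal_complement_line_subset by blast
  then show "Inc_ideal n (n + r) ?I \<subseteq> path_ideal (n + r)"
    unfolding Inc_ideal_def by (intro S.genideal_minimal ideal_path_ideal)
  have G_carr: "?G \<subseteq> carrier (poly_ring_in (n + r))"
    using G by (auto simp: path_ideal_def)
  show "path_ideal (n + r) \<subseteq> Inc_ideal n (n + r) ?I"
    unfolding Inc_ideal_def
  proof (rule path_ideal_minimal[OF S.genideal_ideal[OF G_carr]])
    fix a b assume "1 \<le> a" "a + 1 < b" "b \<le> n + r"
    from exists_Inc_edge[OF n this]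
    obtain \<pi> i j where ij: "\<pi> \<in> Inc n (n + r)" "1 \<le> i" "i + 1 < j" "j \<le> n" "\<pi> i = a" "\<pi> j = b" .
    have "{i, j} \<in> complement_edges n (line_edges n)"
    proof -
      have "i \<in> {1..n}" "j \<in> {1..n}" "i \<noteq> j" using ij(2-4) by auto
      moreover have "{i, j} \<notin> line_edges n"
        using ij(3) by (auto simp: line_edges_def doubleton_eq_iff)
      ultimately show ?thesis unfolding complement_edges_def by blast
    qed
    then have "(var i * var j :: 'k mpoly) \<in> {var i * var j | i j. {i, j} \<in> complement_edges n (line_edges n)}"
      by blast
    moreover have "{var i * var j | i j. {i, j} \<in> complement_edges n (line_edges n)}
        \<subseteq> carrier (poly_ring_in n :: 'k mpoly ring)"
      by (auto simp: complement_edges_def doubleton_eq_iff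
          intro!: poly_ring_in_closed var_in_poly_ring_in)
    ultimately have "(var i * var j :: 'k mpoly) \<in> ?I"
      unfolding edge_ideal_def using R.genideal_self by blast
    then have "var_map \<pi> (var i * var j :: 'k mpoly) \<in> ?G" using ij(1) by blast
    then have "(var a * var b :: 'k mpoly) \<in> ?G"
      using ij(3,5,6) by (simp add: var_map_var_times_var)
    then show "(var a * var b :: 'k mpoly) \<in> genideal (poly_ring_in (n + r)) ?G"
      using S.genideal_self[OF G_carr] by blast
  qed
qed


section \<open>Dimension at most two\<close>

text \<open>
  A homogeneous linear system with fewer equations than unknowns has a nonzero solution, by Gaussian
  elimination.  The unknowns and equations are indexed by finite sets, here triples of exponents and
  monomials.
\<close>

lemma exists_nontrivial_solution:
  fixes A :: "'e \<Rightarrow> 'x \<Rightarrow> 'k::field"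
  assumes "finite E" "finite S" "card E < card S"
  shows "\<exists>c. (\<exists>x\<in>S. c x \<noteq> 0) \<and> (\<forall>e\<in>E. (\<Sum>x\<in>S. A e x * c x) = 0)"
  using assms
proof (induction E arbitrary: S A rule: finite_induct)
  case empty
  then have "S \<noteq> {}" by auto
  then show ?case by (intro exI[of _ "\<lambda>_. 1"]) auto
next
  case (insert e E)
  show ?case
  proof (cases "\<forall>x\<in>S. A e x = 0")
    case True
    have "card E < card S" using insert by simp
    then obtain c where "\<exists>x\<in>S. c x \<noteq> 0" "\<forall>e\<in>E. (\<Sum>x\<in>S. A e x * c x) = 0"
      using insert.IH[OF insert.prems(1)] by blast
    then show ?thesis using True by (intro exI[of _ c]) simp
  next
    case False
    then obtain y where y: "y \<in> S" "A e y \<noteq> 0" by blast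
    define T where "T = S - {y}"
    have T: "finite T" "card E < card T" "y \<notin> T" "S = insert y T"
      using insert y by (auto simp: T_def)
    (* Eliminate the unknown y by means of the equation e. *)
    define B where "B e' x = A e' x - A e' y * (A e x / A e y)" for e' x
    obtain c where c: "\<exists>x\<in>T. c x \<noteq> 0" "\<forall>e'\<in>E. (\<Sum>x\<in>T. B e' x * c x) = 0"
      using insert.IH[OF T(1,2)] by blast
    define d where "d = c(y := - (\<Sum>x\<in>T. A e x * c x) / A e y)"
    have sum_d: "(\<Sum>x\<in>S. A e' x * d x) = (\<Sum>x\<in>T. B e' x * c x)" for e'
    proof -
      have "(\<Sum>x\<in>S. A e' x * d x) = A e' y * d y + (\<Sum>x\<in>T. A e' x * c x)"
        unfolding T(4) using T(1,3) by (auto simp: d_def intro!: sum.cong)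
      moreover have "(\<Sum>x\<in>T. B e' x * c x) = (\<Sum>x\<in>T. A e' x * c x) + A e' y * d y"
        by (simp add: B_def d_def left_diff_distrib sum_subtractf sum_distrib_left sum_divide_distrib
            mult.assoc)
      ultimately show ?thesis by simp
    qed
    have "(\<Sum>x\<in>T. B e x * c x) = 0" using y(2) by (simp add: B_def)
    then have "\<forall>e'\<in>insert e E. (\<Sum>x\<in>S. A e' x * d x) = 0" using sum_d c(2) by simp
    moreover have "\<exists>x\<in>S. d x \<noteq> 0" using c(1) T(3,4) by (auto simp: d_def)
    ultimately show ?thesis by blast
  qed
qed

text \<open>
  For \<open>a \<in> Q - P\<close>, a relation \<open>\<Sum> a\<^sup>i b\<^sub>i \<in> P\<close> gives \<open>b\<^sub>0 \<in> Q\<close>, hence \<open>b\<^sub>0 = 0\<close>.  Then the prime \<open>P\<close>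
  contains \<open>a\<close> times a shorter sum, so it contains that sum.
\<close>

lemma coefficients_eq_0_of_prime_pair:
  fixes a :: "'k::field mpoly"
  assumes P: "primeideal P (poly_ring_in m)" and Q: "primeideal Q (poly_ring_in m)" "P \<subseteq> Q"
    and a: "a \<in> Q" "a \<notin> P"
    and b: "\<And>i. i < N \<Longrightarrow> b i \<in> carrier (poly_ring_in m)" "\<And>i. i < N \<Longrightarrow> b i \<in> Q \<Longrightarrow> b i = 0"
    and sum: "(\<Sum>i<N. a ^ i * b i) \<in> P"
  shows "\<forall>i<N. b i = 0"
  using b sum
proof (induction N arbitrary: b)
  case (Suc N)
  note PD = ideal_poly_ring_inD[OF primeideal.axioms(1)[OF P]]
  note QD = ideal_poly_ring_inD[OF primeideal.axioms(1)[OF Q(1)]]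
  define S where "S = (\<Sum>i<N. a ^ i * b (Suc i))"
  have a_carr: "a \<in> carrier (poly_ring_in m)" using a(1) QD by blast
  have S_carr: "S \<in> carrier (poly_ring_in m)"
    unfolding S_def by (intro sum_in_poly_ring_in poly_ring_in_closed power_in_poly_ring_in a_carr Suc.prems) auto
  have sum_eq: "(\<Sum>i<Suc N. a ^ i * b i) = b 0 + S * a"
    unfolding S_def sum.lessThan_Suc_shift by (simp add: sum_distrib_left sum_distrib_right ac_simps)
  have "(b 0 + S * a) - S * a \<in> Q"
    using QD(3)[OF subsetD[OF Q(2) Suc.prems(3)] QD(4)[OF a(1) S_carr]] unfolding sum_eq .
  then have b0: "b 0 = 0" using Suc.prems(2)[of 0] by simp
  then have "S \<otimes>\<^bsub>poly_ring_in m\<^esub> a \<in> P" using Suc.prems(3) unfolding sum_eq by simp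
  then have "S \<in> P" using primeideal.I_prime[OF P S_carr a_carr] a(2) by blast
  then have "\<forall>i<N. b (Suc i) = 0"
    unfolding S_def using Suc.prems by (intro Suc.IH) auto
  then show ?case using b0 less_Suc_eq_0_disj by auto
qed simp

lemma scalar_eq_0_iff [simp]: "scalar c = 0 \<longleftrightarrow> c = 0"
  by (metis lookup_single_eq lookup_zero scalar_def single_zero)

lemma scalar_0 [simp]: "scalar 0 = 0"
  by simp

lemma scalar_in_primeideal:
  assumes P: "primeideal P (poly_ring_in m :: 'k::field mpoly ring)" and c: "scalar c \<in> P"
  shows "c = 0"
proof (rule ccontr)
  assume "c \<noteq> 0"
  then have "scalar (1 / c) * scalar c = (1 :: 'k mpoly)"
    by (simp add: scalar_def mult_single flip: single_one)
  then have "1 \<in> P"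
    using ideal_poly_ring_inD(4)[OF primeideal.axioms(1)[OF P] c scalar_in_poly_ring_in, of "1 / c"] by simp
  then show False
    using ideal.one_imp_carrier[OF primeideal.axioms(1)[OF P]] primeideal.I_notcarr[OF P] by simp
qed

text \<open>
  The single variable statement is applied three times to the nested sum, once for each step of the
  chain: a coefficient polynomial in \<open>a\<^sub>1, a\<^sub>2\<close> that lies in \<open>P\<^sub>1\<close> vanishes by the same statement one step
  higher up, and so on down to the scalars, which are in \<open>P\<^sub>3\<close> only if they are zero.
\<close>

lemma prime_chain_algebraically_independent:
  fixes a :: "nat \<Rightarrow> 'k::field mpoly" and c :: "nat \<Rightarrow> nat \<Rightarrow> nat \<Rightarrow> 'k"
  assumes P: "\<And>i. i \<le> 3 \<Longrightarrow> primeideal (P i) (poly_ring_in m)"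
    and sub: "\<And>i. i < 3 \<Longrightarrow> P i \<subseteq> P (Suc i)"
    and a: "\<And>i. i < 3 \<Longrightarrow> a i \<in> P (Suc i)" "\<And>i. i < 3 \<Longrightarrow> a i \<notin> P i"
    and sum: "(\<Sum>i<N. a 0 ^ i * (\<Sum>j<N. a 1 ^ j * (\<Sum>k<N. a 2 ^ k * scalar (c i j k)))) \<in> P 0"
  shows "\<forall>i<N. \<forall>j<N. \<forall>k<N. c i j k = 0"
proof -
  have a_carr: "a i \<in> carrier (poly_ring_in m)" if "i < 3" for i
    using ideal_poly_ring_inD(5)[OF primeideal.axioms(1)[OF P] a(1)[OF that]] that by simp
  define b2 where "b2 i j = (\<Sum>k<N. a 2 ^ k * scalar (c i j k))" for i j
  define b1 where "b1 i = (\<Sum>j<N. a 1 ^ j * b2 i j)" for i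
  have b2_carr: "b2 i j \<in> carrier (poly_ring_in m)" for i j
    unfolding b2_def
    by (intro sum_in_poly_ring_in poly_ring_in_closed power_in_poly_ring_in a_carr scalar_in_poly_ring_in) simp
  have b1_carr: "b1 i \<in> carrier (poly_ring_in m)" for i
    unfolding b1_def
    by (intro sum_in_poly_ring_in poly_ring_in_closed power_in_poly_ring_in a_carr b2_carr) simp
  have P': "primeideal (P 0) (poly_ring_in m)" "primeideal (P 1) (poly_ring_in m)"
      "primeideal (P 2) (poly_ring_in m)" "primeideal (P 3) (poly_ring_in m)"
    using P by simp_all
  have sub': "P 0 \<subseteq> P 1" "P 1 \<subseteq> P 2" "P 2 \<subseteq> P 3"
    using sub[of 0] sub[of 1] sub[of 2] by (simp_all add: numeral_2_eq_2 numeral_3_eq_3)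
  have a': "a 0 \<in> P 1" "a 0 \<notin> P 0" "a 1 \<in> P 2" "a 1 \<notin> P 1" "a 2 \<in> P 3" "a 2 \<notin> P 2"
    using a[of 0] a[of 1] a[of 2] by (simp_all add: numeral_2_eq_2 numeral_3_eq_3)
  have c0: "\<forall>k<N. c i j k = 0" if "b2 i j \<in> P 2" for i j
  proof -
    have "\<forall>k<N. scalar (c i j k) = 0"
      using that unfolding b2_def
      by (intro coefficients_eq_0_of_prime_pair[OF P'(3,4) sub'(3) a'(5,6)])
        (auto simp: scalar_in_poly_ring_in dest: scalar_in_primeideal[OF P'(4)])
    then show ?thesis by simp
  qed
  have b2_0: "\<forall>j<N. b2 i j = 0" if "b1 i \<in> P 1" for i
  proof (rule coefficients_eq_0_of_prime_pair[OF P'(2,3) sub'(2) a'(3,4) b2_carr])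
    show "b2 i j = 0" if "b2 i j \<in> P 2" for j
      using c0[OF that] by (simp add: b2_def)
    show "(\<Sum>j<N. a 1 ^ j * b2 i j) \<in> P 1" using that by (simp add: b1_def)
  qed
  have "\<forall>i<N. b1 i = 0"
  proof (rule coefficients_eq_0_of_prime_pair[OF P'(1,2) sub'(1) a'(1,2) b1_carr])
    show "b1 i = 0" if "b1 i \<in> P 1" for i
      using b2_0[OF that] by (simp add: b1_def)
    show "(\<Sum>i<N. a 0 ^ i * b1 i) \<in> P 0" using sum by (simp add: b1_def b2_def)
  qed
  moreover have "0 \<in> P 1" "0 \<in> P 2"
    using ideal_poly_ring_inD(1)[OF primeideal.axioms(1)] P' by blast+
  ultimately show ?thesis using b2_0 c0 by metis
qed

definition exponents_le :: "nat \<Rightarrow> 'k::zero mpoly \<Rightarrow> bool" where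
  "exponents_le D p \<longleftrightarrow> (\<forall>t\<in>Poly_Mapping.keys p. \<forall>i. Poly_Mapping.lookup t i \<le> D)"

lemma exponents_le_times:
  fixes p q :: "'k::field mpoly"
  assumes "exponents_le D p" "exponents_le D' q" shows "exponents_le (D + D') (p * q)"
  unfolding exponents_le_def
proof (intro ballI allI)
  fix t i assume "t \<in> Poly_Mapping.keys (p * q)"
  then obtain u v where "t = u + v" "u \<in> Poly_Mapping.keys p" "v \<in> Poly_Mapping.keys q"
    using keys_mult[of p q] by blast
  then show "Poly_Mapping.lookup t i \<le> D + D'"
    using assms by (simp add: exponents_le_def lookup_add add_mono)
qed

lemma exponents_le_power:
  fixes p :: "'k::field mpoly"
  assumes "exponents_le D p" shows "exponents_le (n * D) (p ^ n)"
proof (induction n)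
  case 0
  then show ?case by (simp add: exponents_le_def flip: single_one)
next
  case (Suc n)
  then show ?case using exponents_le_times[OF assms Suc] by simp
qed

lemma exponents_le_mono: "exponents_le D p \<Longrightarrow> D \<le> D' \<Longrightarrow> exponents_le D' p"
  unfolding exponents_le_def by (meson le_trans)

lemma exponents_le_exists: "\<exists>D. exponents_le D p"
proof -
  have "finite (\<Union>t\<in>Poly_Mapping.keys p. Poly_Mapping.lookup t ` Poly_Mapping.keys t)" (is "finite ?V")
    by simp
  then obtain D where D: "\<forall>v\<in>?V. v \<le> D" using finite_nat_set_iff_bounded_le by auto
  have "Poly_Mapping.lookup t i \<le> D" if "t \<in> Poly_Mapping.keys p" for t i
    using D that by (cases "i \<in> Poly_Mapping.keys t") (auto simp: in_keys_iff)
  then show ?thesis unfolding exponents_le_def by blast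
qed

definition bounded_faces :: "nat \<Rightarrow> nat \<Rightarrow> (nat \<Rightarrow>\<^sub>0 nat) set" where
  "bounded_faces m D =
    {t. face t \<and> Poly_Mapping.keys t \<subseteq> {1..m} \<and> (\<forall>i. Poly_Mapping.lookup t i \<le> D)}"

text \<open>
  Such a monomial is determined by an index \<open>i\<close> whose edge \<open>{i, i + 1}\<close> contains its support and by two
  exponents; the quadratic growth in \<open>D\<close> is what makes the dimension at most 2.
\<close>

lemma card_bounded_faces:
  assumes "m \<ge> 1"
  shows "finite (bounded_faces m D)" "card (bounded_faces m D) \<le> m * (D + 1)\<^sup>2"
proof -
  define F where "F = (\<lambda>(i, u, v). Poly_Mapping.single i u + Poly_Mapping.single (i + 1) v :: nat \<Rightarrow>\<^sub>0 nat)"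
  let ?I = "{1..m} \<times> {..D} \<times> {..D}"
  have sub: "bounded_faces m D \<subseteq> F ` ?I"
  proof
    fix t assume t: "t \<in> bounded_faces m D"
    have *: "t \<in> F ` ?I" if i: "i \<in> {1..m}" "Poly_Mapping.keys t \<subseteq> {i, i + 1}" for i
    proof
      show "t = F (i, Poly_Mapping.lookup t i, Poly_Mapping.lookup t (i + 1))"
      proof (rule poly_mapping_eqI)
        fix k
        show "Poly_Mapping.lookup t k
            = Poly_Mapping.lookup (F (i, Poly_Mapping.lookup t i, Poly_Mapping.lookup t (i + 1))) k"
        proof (cases "k \<in> Poly_Mapping.keys t")
          case True
          then have "k = i \<or> k = i + 1" using i(2) by blast
          then show ?thesis by (auto simp: F_def lookup_add lookup_single)
        next
          case False
          then show ?thesis by (auto simp: F_def lookup_add lookup_single when_def in_keys_iff)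
        qed
      qed
      show "(i, Poly_Mapping.lookup t i, Poly_Mapping.lookup t (i + 1)) \<in> ?I"
        using t i(1) by (simp add: bounded_faces_def)
    qed
    show "t \<in> F ` ?I"
    proof (cases "Poly_Mapping.keys t = {}")
      case True
      then show ?thesis using *[of 1] assms by simp
    next
      case False
      define i where "i = Min (Poly_Mapping.keys t)"
      have i: "i \<in> Poly_Mapping.keys t" using False by (simp add: i_def)
      have "j = i \<or> j = i + 1" if "j \<in> Poly_Mapping.keys t" for j
      proof -
        have "i \<le> j" using that by (simp add: i_def)
        moreover have "j \<le> i + 1" using t i that by (auto simp: bounded_faces_def face_def)
        ultimately show ?thesis by linarith
      qed
      then have "Poly_Mapping.keys t \<subseteq> {i, i + 1}" by blast
      moreover have "i \<in> {1..m}" using i t unfolding bounded_faces_def by blast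
      ultimately show ?thesis using * by blast
    qed
  qed
  then show "finite (bounded_faces m D)" by (rule finite_subset) simp
  have "card (bounded_faces m D) \<le> card (F ` ?I)" using sub by (intro card_mono) auto
  also have "\<dots> \<le> card ?I" by (rule card_image_le) simp
  also have "\<dots> = m * (D + 1)\<^sup>2" by (simp add: card_cartesian_product power2_eq_square)
  finally show "card (bounded_faces m D) \<le> m * (D + 1)\<^sup>2" .
qed

text \<open>
  There are \<open>N\<^sup>3\<close> products \<open>a\<^sub>0\<^sup>i a\<^sub>1\<^sup>j a\<^sub>2\<^sup>k\<close> with \<open>i, j, k < N\<close>.  Their exponents are bounded by a multiple of \<open>N\<close>, so
  the number of coefficients at faces grows only like \<open>N\<^sup>2\<close>.  For large \<open>N\<close> some nontrivial linear combination
  has no face among its monomials.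
\<close>

lemma algebraic_relation_mod_path_ideal:
  fixes a0 a1 a2 :: "'k::field mpoly"
  assumes m: "m \<ge> 1"
    and carr: "a0 \<in> carrier (poly_ring_in m)" "a1 \<in> carrier (poly_ring_in m)" "a2 \<in> carrier (poly_ring_in m)"
  obtains N c where
    "(\<Sum>i<N. a0 ^ i * (\<Sum>j<N. a1 ^ j * (\<Sum>k<N. a2 ^ k * scalar (c i j k)))) \<in> path_ideal m"
    "\<exists>i<N. \<exists>j<N. \<exists>k<N. c i j k \<noteq> (0 :: 'k)"
proof -
  obtain D0 D1 D2 where D: "exponents_le D0 a0" "exponents_le D1 a1" "exponents_le D2 a2"
    using exponents_le_exists by metis
  define d where "d = D0 + D1 + D2"
  (* There are at most m (d N + 1)^2 faces to kill, which is at most m (d + 1)^2 N^2 and so below N^3. *)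
  define N where "N = m * (d + 1)\<^sup>2 + 1"
  let ?I = "{..<N} \<times> {..<N} \<times> {..<N}"
  define p where "p = (\<lambda>(i, j, k). a0 ^ i * (a1 ^ j * a2 ^ k))"
  have p_exp: "exponents_le (d * N) (p x)" if "x \<in> ?I" for x
  proof -
    obtain i j k where x: "x = (i, j, k)" by (cases x)
    have ijk: "i \<le> N" "j \<le> N" "k \<le> N" using that by (simp_all add: x)
    have "exponents_le (i * D0 + (j * D1 + k * D2)) (p x)"
      unfolding x p_def prod.case by (intro exponents_le_times exponents_le_power D)
    moreover have "i * D0 + (j * D1 + k * D2) \<le> N * D0 + (N * D1 + N * D2)"
      using ijk by (intro add_mono mult_right_mono) auto
    ultimately show ?thesis
      by (elim exponents_le_mono) (simp add: d_def algebra_simps)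
  qed
  have "card (bounded_faces m (d * N)) \<le> m * (d * N + 1)\<^sup>2" by (rule card_bounded_faces[OF m])
  also have "\<dots> \<le> m * ((d + 1) * N)\<^sup>2"
    by (intro mult_left_mono power_mono) (auto simp: N_def algebra_simps)
  also have "\<dots> = (m * (d + 1)\<^sup>2) * N\<^sup>2" by (simp only: power_mult_distrib mult.assoc)
  also have "\<dots> < N * N\<^sup>2" by (intro mult_strict_right_mono) (auto simp: N_def)
  also have "\<dots> = card ?I" by (simp add: card_cartesian_product power2_eq_square)
  finally have "card (bounded_faces m (d * N)) < card ?I" .
  then obtain c where c: "\<exists>x\<in>?I. c x \<noteq> 0"
      "\<forall>t\<in>bounded_faces m (d * N). (\<Sum>x\<in>?I. Poly_Mapping.lookup (p x) t * c x) = 0"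
    using exists_nontrivial_solution[of "bounded_faces m (d * N)" ?I "\<lambda>t x. Poly_Mapping.lookup (p x) t"]
      card_bounded_faces(1)[OF m] by auto
  define q where "q = (\<Sum>x\<in>?I. scalar (c x) * p x)"
  have p_carr: "p x \<in> carrier (poly_ring_in m)" for x
    unfolding p_def by (cases x) (simp add: poly_ring_in_closed power_in_poly_ring_in carr)
  have q_carr: "q \<in> carrier (poly_ring_in m)"
    unfolding q_def by (intro sum_in_poly_ring_in poly_ring_in_closed scalar_in_poly_ring_in p_carr)
  have lookup_q: "Poly_Mapping.lookup q t = (\<Sum>x\<in>?I. Poly_Mapping.lookup (p x) t * c x)" for t
  proof -
    have "Poly_Mapping.lookup (scalar (c x) * p x) t = Poly_Mapping.lookup (p x) t * c x" for x
      using lookup_single_times[of 0 "c x" "p x" t] by (simp add: scalar_def mult.commute)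
    then show ?thesis by (simp add: q_def lookup_sum)
  qed
  have "\<not> face t" if t: "t \<in> Poly_Mapping.keys q" for t
  proof
    assume face: "face t"
    have "(\<Sum>x\<in>?I. Poly_Mapping.lookup (p x) t * c x) \<noteq> 0" using t by (simp add: in_keys_iff lookup_q)
    then obtain x where x: "x \<in> ?I" "Poly_Mapping.lookup (p x) t * c x \<noteq> 0"
      by (meson sum.neutral)
    then have "t \<in> Poly_Mapping.keys (p x)" by (auto simp: in_keys_iff)
    then have "t \<in> bounded_faces m (d * N)"
      using face p_exp[OF x(1)] q_carr t
      by (auto simp: bounded_faces_def exponents_le_def mem_poly_ring_in_iff)
    then show False using c(2) t by (auto simp: in_keys_iff lookup_q)
  qed
  then have "q \<in> path_ideal m" using q_carr by (auto simp: path_ideal_def)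
  moreover have "q = (\<Sum>i<N. a0 ^ i * (\<Sum>j<N. a1 ^ j * (\<Sum>k<N. a2 ^ k * scalar (c (i, j, k)))))"
    by (simp add: q_def p_def sum.cartesian_product' sum_distrib_left ac_simps)
  ultimately show thesis using that[where N = N and c = "\<lambda>i j k. c (i, j, k)"] c(1) by force
qed

text \<open>
  A chain of four primes in the quotient is pulled back to the polynomial ring, where all four contain
  \<open>path_ideal m\<close>; the relation that holds modulo this ideal then contradicts independence.
\<close>

lemma krull_dim_path_quotient_le:
  assumes m: "m \<ge> 1"
  shows "krull_dim (poly_ring_in m Quot (path_ideal m :: 'k::field mpoly set)) \<le> 2"
proof -
  let ?R = "poly_ring_in m :: 'k mpoly ring" and ?I = "path_ideal m :: 'k mpoly set"
  interpret R: cring ?R by (rule cring_poly_ring_in)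
  interpret I: ideal ?I ?R by (rule ideal_path_ideal)
  have le: "l \<le> 2" if prime: "\<forall>i\<le>l. primeideal (P i) (?R Quot ?I)"
    and chain: "\<forall>i<l. P i \<subset> P (Suc i)" for l and P :: "nat \<Rightarrow> 'k mpoly set set"
  proof (rule ccontr)
    assume "\<not> l \<le> 2"
    then have l: "3 \<le> l" by simp
    define Q where "Q i = {r \<in> carrier ?R. ?I +>\<^bsub>?R\<^esub> r \<in> P i}" for i
    have Q: "primeideal (Q i) ?R" if "i \<le> 3" for i
      unfolding Q_def using prime that l
      by (intro ring_hom_ring.primeideal_vimage[OF I.rcos_ring_hom_ring R.is_cring]) simp
    have sub: "Q i \<subseteq> Q (Suc i)" if "i < 3" for i
    proof -
      have "P i \<subset> P (Suc i)" using chain that l by simp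
      then show ?thesis unfolding Q_def by blast
    qed
    have "\<exists>r. r \<in> Q (Suc i) \<and> r \<notin> Q i" if i: "i < 3" for i
    proof -
      obtain x where x: "x \<in> P (Suc i)" "x \<notin> P i" using chain i l by (meson less_le_trans psubsetE subsetI)
      then have "x \<in> carrier (?R Quot ?I)"
        using prime i l ideal.Icarr[OF primeideal.axioms(1)] by (metis Suc_le_eq le_trans)
      then show ?thesis using x by (auto simp: I.carrier_quotient Q_def)
    qed
    then obtain a where a: "\<And>i. i < 3 \<Longrightarrow> a i \<in> Q (Suc i)" "\<And>i. i < 3 \<Longrightarrow> a i \<notin> Q i"
      by metis
    have a_carr: "a i \<in> carrier ?R" if "i < 3" for i using a(1)[OF that] by (simp add: Q_def)
    have a012: "a 0 \<in> carrier ?R" "a 1 \<in> carrier ?R" "a 2 \<in> carrier ?R"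
      using a_carr by simp_all
    obtain N c where rel:
      "(\<Sum>i<N. a 0 ^ i * (\<Sum>j<N. a 1 ^ j * (\<Sum>k<N. a 2 ^ k * scalar (c i j k)))) \<in> ?I"
      and c: "\<exists>i<N. \<exists>j<N. \<exists>k<N. c i j k \<noteq> (0 :: 'k)"
      by (rule algebraic_relation_mod_path_ideal[OF m a012]) (rule that; assumption)
    have I_sub: "?I \<subseteq> Q 0"
    proof
      fix f assume f: "f \<in> ?I"
      have "?I \<in> P 0"
        using additive_subgroup.zero_closed[OF ideal.axioms(1)[OF primeideal.axioms(1)]] prime
        by (force simp: FactRing_def)
      then show "f \<in> Q 0"
        using f R.a_rcos_zero[OF ideal_path_ideal f] I.Icarr[OF f] by (simp add: Q_def)
    qed
    have "\<forall>i<N. \<forall>j<N. \<forall>k<N. c i j k = 0"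
      by (rule prime_chain_algebraically_independent[where P = Q and a = a and m = m])
        (use Q sub a subsetD[OF I_sub rel] in blast)+
    then show False using c by blast
  qed
  show ?thesis
    unfolding krull_dim_def
  proof (rule Sup_least)
    fix x
    assume "x \<in> {enat l | l. \<exists>P. (\<forall>i\<le>l. primeideal (P i) (?R Quot ?I)) \<and> (\<forall>i<l. P i \<subset> P (Suc i))}"
    then obtain l where "x = enat l" "l \<le> 2" using le by blast
    then show "x \<le> 2" by (simp add: numeral_eq_enat eval_nat_numeral)
  qed
qed


section \<open>A regular sequence of length two\<close>

definition parity_sum :: "nat \<Rightarrow> bool \<Rightarrow> 'k::field mpoly" where
  "parity_sum m b = (\<Sum>i\<in>{i\<in>{1..m}. even i = b}. var i)"

lemma parity_sum_in_poly_ring_in: "parity_sum m b \<in> carrier (poly_ring_in m)"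
  unfolding parity_sum_def by (intro sum_in_poly_ring_in var_in_poly_ring_in) auto

lemma lookup_var_times_eq_0:
  "i \<notin> Poly_Mapping.keys t \<Longrightarrow> Poly_Mapping.lookup (var i * (f :: 'k::field mpoly)) t = 0"
  using keys_var_times[of t i f] by (auto simp: in_keys_iff)

text \<open>
  Exponent vectors are added when monomials are multiplied, so this is \<open>x\<^sub>i\<close> times the monomial \<open>t\<close>.
\<close>

definition vtimes :: "nat \<Rightarrow> (nat \<Rightarrow>\<^sub>0 nat) \<Rightarrow> (nat \<Rightarrow>\<^sub>0 nat)" where
  "vtimes i t = Poly_Mapping.single i 1 + t"

lemma keys_vtimes [simp]: "Poly_Mapping.keys (vtimes i t) = insert i (Poly_Mapping.keys t)"
  by (simp add: vtimes_def keys_plus_nat)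

lemma vtimes_left_commute: "vtimes i (vtimes j t) = vtimes j (vtimes i t)"
  unfolding vtimes_def by (rule add.left_commute)

lemma face_vtimesD: "face (vtimes i t) \<Longrightarrow> face t"
  by (simp add: face_def)

text \<open>
  Two vertices of equal parity never lie in a common face, so \<open>x\<^sub>i\<close> is the only summand that
  contributes to a coefficient at a face containing \<open>i\<close>.
\<close>

lemma lookup_parity_sum_times:
  fixes f :: "'k::field mpoly"
  assumes "face (vtimes i t)" "Poly_Mapping.keys (vtimes i t) \<subseteq> {1..m}" "even i = b"
  shows "Poly_Mapping.lookup (parity_sum m b * f) (vtimes i t) = Poly_Mapping.lookup f t"
proof -
  let ?V = "{j\<in>{1..m}. even j = b}"
  have "Poly_Mapping.lookup (parity_sum m b * f) (vtimes i t)
      = (\<Sum>j\<in>?V. Poly_Mapping.lookup (var j * f) (vtimes i t))"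
    by (simp only: parity_sum_def sum_distrib_right lookup_sum)
  also have "\<dots> = (\<Sum>j\<in>{i}. Poly_Mapping.lookup (var j * f) (vtimes i t))"
  proof (rule sum.mono_neutral_right)
    show "{i} \<subseteq> ?V" using assms(2,3) unfolding keys_vtimes by blast
    show "\<forall>j\<in>?V - {i}. Poly_Mapping.lookup (var j * f) (vtimes i t) = 0"
    proof
      fix j assume j: "j \<in> ?V - {i}"
      have "j \<notin> Poly_Mapping.keys (vtimes i t)"
      proof
        assume "j \<in> Poly_Mapping.keys (vtimes i t)"
        then have "j \<le> i + 1" "i \<le> j + 1"
          using assms(1) unfolding face_def keys_vtimes by blast+
        then have "j = i + 1 \<or> i = j + 1" using j by auto
        then show False using j assms(3) by auto
      qed
      then show "Poly_Mapping.lookup (var j * f) (vtimes i t) = 0"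
        by (rule lookup_var_times_eq_0)
    qed
  qed simp
  also have "\<dots> = Poly_Mapping.lookup f t"
    using lookup_single_times[of "Poly_Mapping.single i 1" 1 f t] unfolding var_def vtimes_def by simp
  finally show ?thesis .
qed

lemma lookup_parity_sum_times_eq_0:
  fixes f :: "'k::field mpoly"
  assumes "\<And>i. i \<in> Poly_Mapping.keys t \<Longrightarrow> even i \<noteq> b"
  shows "Poly_Mapping.lookup (parity_sum m b * f) t = 0"
proof -
  have "Poly_Mapping.lookup (var j * f) t = 0" if "even j = b" for j
    using assms[of j] that by (intro lookup_var_times_eq_0) auto
  then show ?thesis unfolding parity_sum_def sum_distrib_right lookup_sum by (intro sum.neutral) blast
qed

lemma split_key:
  assumes "(i::nat) \<in> Poly_Mapping.keys (t :: nat \<Rightarrow>\<^sub>0 nat)"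
  obtains s where "t = vtimes i s"
proof
  show "t = vtimes i (t - Poly_Mapping.single i 1)"
    using assms unfolding vtimes_def
    by (intro poly_mapping_eqI) (auto simp: lookup_add lookup_minus lookup_single when_def in_keys_iff)
qed

lemma face_same_parity:
  assumes "face t" "i \<in> Poly_Mapping.keys t" "j \<in> Poly_Mapping.keys t" "even i = even j"
  shows "i = j"
proof (rule ccontr)
  assume "i \<noteq> j"
  moreover have "j \<le> i + 1" "i \<le> j + 1" using assms(1-3) by (auto simp: face_def)
  ultimately have "j = i + 1 \<or> i = j + 1" by auto
  then show False using assms(4) by auto
qed

lemma no_odd_key_cases:
  assumes "face t" "Poly_Mapping.keys t \<subseteq> {1..m}" "\<not> (\<exists>i\<in>Poly_Mapping.keys t. odd i)"
  obtains "t = 0" | e where "Poly_Mapping.keys t = {e}" "even e" "2 \<le> e" "e \<le> m"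
proof (cases "t = 0")
  case False
  then obtain e where e: "e \<in> Poly_Mapping.keys t" by (metis all_not_in_conv keys_eq_empty)
  have "Poly_Mapping.keys t = {e}"
  proof (intro equalityI subsetI)
    show "i \<in> {e}" if "i \<in> Poly_Mapping.keys t" for i
      using face_same_parity[OF assms(1) that e] assms(3) that e by auto
  qed (use e in simp)
  moreover have "even e" "1 \<le> e" "e \<le> m" using assms e by auto
  moreover have "2 \<le> e" using \<open>even e\<close> \<open>1 \<le> e\<close> by presburger
  ultimately show thesis using that(2) by blast
qed (rule that(1))

text \<open>
  Every facet of the path has an odd vertex; a face without one is empty or a single even vertex
  \<open>e\<close>, and \<open>e - 1 \<ge> 1\<close> is then available.
\<close>

lemma exists_odd_link:
  assumes "face t" "Poly_Mapping.keys t \<subseteq> {1..m}" "m \<ge> 1"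
  obtains i where "i \<in> {1..m}" "odd i" "face (vtimes i t)"
proof (cases "\<exists>i\<in>Poly_Mapping.keys t. odd i")
  case True
  then obtain i where i: "i \<in> Poly_Mapping.keys t" "odd i" by blast
  have "face (vtimes i t)" using assms(1) insert_absorb[OF i(1)] by (simp add: face_def)
  then show thesis using that[of i] i assms(2) by blast
next
  case False
  with assms(1,2) show thesis
  proof (cases rule: no_odd_key_cases)
    case 1
    then show thesis using that[of 1] assms(3) by (simp add: face_def)
  next
    case (2 e)
    then have "1 \<le> e - 1" "e - 1 \<le> m" "e \<le> (e - 1) + 1" "e - 1 \<le> e + 1" by linarith+
    then show thesis using that[of "e - 1"] 2 by (simp add: face_def)
  qed
qed

text \<open>
  A face monomial of \<open>f\<close> stays a face when multiplied by a suitable odd variable, and the product has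
  in \<open>parity_sum m False * f\<close> the coefficient that the monomial has in \<open>f\<close>.
\<close>

lemma odd_sum_regular:
  fixes f :: "'k::field mpoly"
  assumes m: "m \<ge> 1" and f: "f \<in> carrier (poly_ring_in m)"
    and prod: "parity_sum m False * f \<in> path_ideal m"
  shows "f \<in> path_ideal m"
proof -
  have "\<not> face t" if t: "t \<in> Poly_Mapping.keys f" for t
  proof
    assume "face t"
    have tm: "Poly_Mapping.keys t \<subseteq> {1..m}" using f t by (auto simp: mem_poly_ring_in_iff)
    obtain i where i: "i \<in> {1..m}" "odd i" "face (vtimes i t)"
      using exists_odd_link[OF \<open>face t\<close> tm m] .
    have "Poly_Mapping.lookup (parity_sum m False * f) (vtimes i t) = Poly_Mapping.lookup f t"
      using i tm by (intro lookup_parity_sum_times) auto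
    then have "vtimes i t \<in> Poly_Mapping.keys (parity_sum m False * f)"
      using t by (simp add: in_keys_iff)
    then show False using prod i(3) by (auto simp: path_ideal_def)
  qed
  then show ?thesis using f by (auto simp: path_ideal_def)
qed

text \<open>
  Write \<open>\<theta>\<^sub>o\<close> and \<open>\<theta>\<^sub>e\<close> for the two sums.  Comparing coefficients in \<open>\<theta>\<^sub>e f \<equiv> \<theta>\<^sub>o g\<close> at faces gives two facts:
  \<open>f\<close> has no face monomial free of odd variables (\<open>f_even\<close>), and the coefficient of \<open>f\<close> at
  \<open>x\<^sub>j t\<close> equals that of \<open>g\<close> at \<open>x\<^sub>e t\<close> for \<open>j\<close> odd and \<open>e\<close> even in a common face with \<open>t\<close> (\<open>f_g\<close>).
  A solution of \<open>f \<equiv> \<theta>\<^sub>o h\<close> must have, at a face \<open>t\<close>, the coefficient of \<open>f\<close> at \<open>x\<^sub>j t\<close> for every odd \<open>j\<close>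
  that can be adjoined to \<open>t\<close>.  These prescriptions agree (\<open>indep\<close>): if \<open>t\<close> is a power of an even variable,
  both neighbours give a coefficient of \<open>g\<close>; if \<open>t = 1\<close>, one walks along the path, and this is where
  its connectedness enters.
\<close>

lemma even_sum_regular_mod_odd_sum:
  fixes f g :: "'k::field mpoly"
  assumes m: "m \<ge> 2" and f: "f \<in> carrier (poly_ring_in m)"
    and eq: "parity_sum m True * f - parity_sum m False * g \<in> path_ideal m"
  shows "\<exists>h \<in> carrier (poly_ring_in m). f - parity_sum m False * h \<in> path_ideal m"
proof -
  have coeff_eq: "Poly_Mapping.lookup (parity_sum m True * f) t
      = Poly_Mapping.lookup (parity_sum m False * g) t" if "face t" for t
    using eq that by (auto simp: path_ideal_def lookup_minus in_keys_iff)
  have f_even: "Poly_Mapping.lookup f t = 0"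
    if t: "face t" "Poly_Mapping.keys t \<subseteq> {1..m}" "\<not> (\<exists>i\<in>Poly_Mapping.keys t. odd i)" for t
  proof -
    obtain e where e: "even e" "2 \<le> e" "e \<le> m" "Poly_Mapping.keys (vtimes e t) = {e}"
      using t
    proof (cases rule: no_odd_key_cases)
      case 1
      then show thesis using that[of 2] m by simp
    next
      case (2 e)
      then show thesis using that[of e] by simp
    qed
    have face: "face (vtimes e t)" unfolding face_def e(4) by simp
    have "Poly_Mapping.lookup f t = Poly_Mapping.lookup (parity_sum m True * f) (vtimes e t)"
      using e by (intro lookup_parity_sum_times[OF face, symmetric]) (simp_all only: e(4), simp)
    also have "\<dots> = Poly_Mapping.lookup (parity_sum m False * g) (vtimes e t)"
      by (rule coeff_eq[OF face])
    also have "\<dots> = 0" using e by (intro lookup_parity_sum_times_eq_0) auto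
    finally show ?thesis .
  qed
  have f_g: "Poly_Mapping.lookup f (vtimes j t) = Poly_Mapping.lookup g (vtimes e t)"
    if "odd j" "even e" and face: "face (vtimes j (vtimes e t))"
      and keys: "Poly_Mapping.keys (vtimes j (vtimes e t)) \<subseteq> {1..m}" for j e t
  proof -
    have swap: "vtimes j (vtimes e t) = vtimes e (vtimes j t)" by (rule vtimes_left_commute)
    have "Poly_Mapping.lookup f (vtimes j t)
        = Poly_Mapping.lookup (parity_sum m True * f) (vtimes e (vtimes j t))"
      using lookup_parity_sum_times[of e "vtimes j t" m True f] that by (simp add: swap)
    also have "\<dots> = Poly_Mapping.lookup (parity_sum m False * g) (vtimes j (vtimes e t))"
      unfolding swap[symmetric] by (rule coeff_eq[OF face])
    also have "\<dots> = Poly_Mapping.lookup g (vtimes e t)"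
      using lookup_parity_sum_times[of j "vtimes e t" m False g] that by simp
    finally show ?thesis .
  qed
  have f_vertex: "Poly_Mapping.lookup f (vtimes (2 * k + 1) 0) = Poly_Mapping.lookup f (vtimes 1 0)"
    if "2 * k + 1 \<le> m" for k
    using that
  proof (induction k)
    case (Suc k)
    have "Poly_Mapping.lookup f (vtimes (2 * Suc k + 1) 0) = Poly_Mapping.lookup g (vtimes (2 * k + 2) 0)"
      using Suc.prems by (intro f_g) (auto simp: face_def)
    also have "\<dots> = Poly_Mapping.lookup f (vtimes (2 * k + 1) 0)"
      using Suc.prems by (intro f_g[symmetric]) (auto simp: face_def)
    finally show ?case using Suc by simp
  qed simp
  have indep: "Poly_Mapping.lookup f (vtimes i t) = Poly_Mapping.lookup f (vtimes j t)"
    if i: "odd i" "i \<in> {1..m}" "face (vtimes i t)" and j: "odd j" "j \<in> {1..m}" "face (vtimes j t)"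
      and tm: "Poly_Mapping.keys t \<subseteq> {1..m}" for i j t
  proof (cases "\<exists>k\<in>Poly_Mapping.keys t. odd k")
    case True
    then obtain k where k: "k \<in> Poly_Mapping.keys t" "odd k" by blast
    have "i = k" "j = k"
      using face_same_parity[OF i(3), of i k] face_same_parity[OF j(3), of j k] i j k
      by auto
    then show ?thesis by simp
  next
    case False
    have "face t" using face_vtimesD i(3) by blast
    from this tm False show ?thesis
    proof (cases rule: no_odd_key_cases)
      case 1
      have "Poly_Mapping.lookup f (vtimes l 0) = Poly_Mapping.lookup f (vtimes 1 0)"
        if "odd l" "l \<in> {1..m}" for l
        using that f_vertex[of "l div 2"] by simp
      then show ?thesis using 1 i j by metis
    next
      case (2 e)
      have "Poly_Mapping.lookup f (vtimes l t) = Poly_Mapping.lookup g (vtimes e t)"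
        if l: "odd l" "l \<in> {1..m}" "face (vtimes l t)" for l
      proof (rule f_g)
        have "Poly_Mapping.keys (vtimes l (vtimes e t)) = Poly_Mapping.keys (vtimes l t)"
          using 2 by simp
        then show "face (vtimes l (vtimes e t))"
            "Poly_Mapping.keys (vtimes l (vtimes e t)) \<subseteq> {1..m}"
          using l tm by (auto simp: face_def)
      qed (use l 2 in auto)
      then show ?thesis using i j by metis
    qed
  qed
  (* Any odd vertex that can be adjoined will do, by indep. *)
  define link where "link t = (SOME i. i \<in> {1..m} \<and> odd i \<and> face (vtimes i t))" for t
  have link: "link t \<in> {1..m}" "odd (link t)" "face (vtimes (link t) t)"
    if t: "face t" "Poly_Mapping.keys t \<subseteq> {1..m}" for t
  proof -
    have "\<exists>i. i \<in> {1..m} \<and> odd i \<and> face (vtimes i t)"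
      using exists_odd_link[OF t] m by (metis le_trans one_le_numeral)
    from someI_ex[OF this] show "link t \<in> {1..m}" "odd (link t)" "face (vtimes (link t) t)"
      unfolding link_def by blast+
  qed
  define H where "H t = (if face t \<and> Poly_Mapping.keys t \<subseteq> {1..m}
    then Poly_Mapping.lookup f (vtimes (link t) t) else 0)" for t
  define h where "h = Abs_poly_mapping H"
  have "{t. H t \<noteq> 0} \<subseteq> (\<Union>i\<in>{1..m}. vtimes i -` Poly_Mapping.keys f)"
  proof
    fix t assume "t \<in> {t. H t \<noteq> 0}"
    then have t: "face t" "Poly_Mapping.keys t \<subseteq> {1..m}" "Poly_Mapping.lookup f (vtimes (link t) t) \<noteq> 0"
      by (auto simp: H_def split: if_splits)
    then have "t \<in> vtimes (link t) -` Poly_Mapping.keys f" by (simp add: in_keys_iff)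
    then show "t \<in> (\<Union>i\<in>{1..m}. vtimes i -` Poly_Mapping.keys f)" using link(1)[OF t(1,2)] by blast
  qed
  moreover have "finite (\<Union>i\<in>{1..m}. vtimes i -` Poly_Mapping.keys f)"
    by (intro finite_UN_I finite_vimageI) (auto simp: inj_on_def vtimes_def)
  ultimately have lookup_h: "Poly_Mapping.lookup h = H"
    unfolding h_def by (simp add: lookup_Abs_poly_mapping finite_subset)
  have h: "h \<in> carrier (poly_ring_in m)"
    unfolding mem_poly_ring_in_iff
  proof
    fix t assume "t \<in> Poly_Mapping.keys h"
    then have "H t \<noteq> 0" by (simp add: in_keys_iff lookup_h)
    then show "Poly_Mapping.keys t \<subseteq> {1..m}" by (simp add: H_def split: if_splits)
  qed
  have "\<not> face t" if "t \<in> Poly_Mapping.keys (f - parity_sum m False * h)" for t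
  proof
    assume face: "face t"
    have "f - parity_sum m False * h \<in> carrier (poly_ring_in m)"
      using f h by (intro poly_ring_in_closed parity_sum_in_poly_ring_in)
    then have tm: "Poly_Mapping.keys t \<subseteq> {1..m}" using that by (auto simp: mem_poly_ring_in_iff)
    have "Poly_Mapping.lookup f t = Poly_Mapping.lookup (parity_sum m False * h) t"
    proof (cases "\<exists>i\<in>Poly_Mapping.keys t. odd i")
      case True
      then obtain i s where i: "i \<in> Poly_Mapping.keys t" "odd i" and t: "t = vtimes i s"
        using split_key by metis
      have s: "face s" "Poly_Mapping.keys s \<subseteq> {1..m}"
        using face face_vtimesD tm unfolding t keys_vtimes by blast+
      have "Poly_Mapping.lookup (parity_sum m False * h) t = H s"
        using lookup_parity_sum_times[of i s m False h] face tm i by (simp add: t lookup_h)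
      also have "\<dots> = Poly_Mapping.lookup f (vtimes (link s) s)"
        using s by (simp add: H_def)
      also have "\<dots> = Poly_Mapping.lookup f t"
        using link[OF s] i face tm s(2) unfolding t by (intro indep) auto
      finally show ?thesis by simp
    next
      case False
      then show ?thesis
        using f_even[OF face tm False] lookup_parity_sum_times_eq_0[of t False m h] by simp
    qed
    then show False using that by (simp add: in_keys_iff lookup_minus)
  qed
  then have "f - parity_sum m False * h \<in> path_ideal m"
    using f h by (auto simp: path_ideal_def intro!: poly_ring_in_closed parity_sum_in_poly_ring_in)
  then show ?thesis using h by blast
qed

lemma ideal_irrelevant_ideal: "ideal (irrelevant_ideal m :: 'k::field mpoly set) (poly_ring_in m)"
proof -
  interpret R: cring "poly_ring_in m :: 'k mpoly ring" by (rule cring_poly_ring_in)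
  show ?thesis
    unfolding irrelevant_ideal_def using var_in_poly_ring_in by (intro R.genideal_ideal) blast
qed

lemma parity_sum_in_irrelevant_ideal: "parity_sum m b \<in> (irrelevant_ideal m :: 'k::field mpoly set)"
proof -
  interpret R: cring "poly_ring_in m :: 'k mpoly ring" by (rule cring_poly_ring_in)
  have gen: "var i \<in> (irrelevant_ideal m :: 'k mpoly set)" if "i \<in> {1..m}" for i
  proof -
    have "var ` {1..m} \<subseteq> (irrelevant_ideal m :: 'k mpoly set)"
      unfolding irrelevant_ideal_def using var_in_poly_ring_in by (intro R.genideal_self) blast
    then show ?thesis using that by blast
  qed
  have sum_mem: "sum var T \<in> (irrelevant_ideal m :: 'k mpoly set)" if "finite T" "T \<subseteq> {1..m}" for T
    using that
    by (induction T rule: finite_induct)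
      (simp_all add: ideal_poly_ring_inD[OF ideal_irrelevant_ideal] gen)
  show ?thesis unfolding parity_sum_def by (rule sum_mem) auto
qed

text \<open>
  This shows that the irrelevant ideal is proper, also modulo \<open>path_ideal m\<close>, since the monomial 1 is
  a face.
\<close>

lemma lookup_0_irrelevant_ideal:
  fixes p :: "'k::field mpoly"
  assumes "p \<in> irrelevant_ideal m"
  shows "Poly_Mapping.lookup p 0 = 0"
proof -
  interpret R: cring "poly_ring_in m :: 'k mpoly ring" by (rule cring_poly_ring_in)
  let ?J = "{p \<in> carrier (poly_ring_in m). Poly_Mapping.lookup p 0 = (0 :: 'k)}"
  have J: "ideal ?J (poly_ring_in m)"
  proof (rule ideal_poly_ring_inI)
    fix p q :: "'k mpoly" assume p: "p \<in> ?J"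
    show "p + q \<in> ?J" if "q \<in> ?J" using p that by (simp add: poly_ring_in_closed lookup_add)
    show "q * p \<in> ?J" if q: "q \<in> carrier (poly_ring_in m)"
    proof -
      have "0 \<notin> Poly_Mapping.keys (q * p)"
      proof
        assume "0 \<in> Poly_Mapping.keys (q * p)"
        then obtain s t where "0 = s + t" "t \<in> Poly_Mapping.keys p"
          using keys_mult[of q p] by blast
        then have "Poly_Mapping.keys t = {}" using keys_plus_nat[of s t] by simp
        then show False using p \<open>t \<in> _\<close> by (simp add: in_keys_iff)
      qed
      then show ?thesis using p q by (simp add: poly_ring_in_closed in_keys_iff)
    qed
  qed (auto simp: mem_poly_ring_in_iff)
  have "var i \<in> ?J" if "i \<in> {1..m}" for i
  proof -
    have "Poly_Mapping.single i (1::nat) \<noteq> 0" by (metis lookup_single_eq lookup_zero zero_neq_one)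
    then show ?thesis using var_in_poly_ring_in[OF that] by (simp add: var_def lookup_single when_def)
  qed
  then have "irrelevant_ideal m \<subseteq> ?J"
    unfolding irrelevant_ideal_def by (intro R.genideal_minimal[OF J]) blast
  then show ?thesis using assms by blast
qed

text \<open>
  The two coefficient statements above, transported to the quotient ring through the quotient map
  \<open>h\<close>.
\<close>

lemma regular_sequence_parity_sums:
  fixes m :: nat
  assumes m: "m \<ge> 2"
  defines "h \<equiv> \<lambda>f :: 'k::field mpoly. path_ideal m +>\<^bsub>poly_ring_in m\<^esub> f"
  shows "regular_sequence (poly_ring_in m Quot path_ideal m)
    [h (parity_sum m False), h (parity_sum m True)]"
proof -
  let ?R = "poly_ring_in m :: 'k mpoly ring" and ?I = "path_ideal m :: 'k mpoly set"
  let ?A = "?R Quot ?I"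
  interpret R: cring ?R by (rule cring_poly_ring_in)
  interpret I: ideal ?I ?R by (rule ideal_path_ideal)
  interpret A: cring ?A by (rule I.quotient_is_cring[OF R.is_cring])
  have h: "h \<in> ring_hom ?R ?A" unfolding h_def by (rule I.rcos_ring_hom)
  have h_mult: "h f \<otimes>\<^bsub>?A\<^esub> h g = h (f * g)" if "f \<in> carrier ?R" "g \<in> carrier ?R" for f g
    using ring_hom_mult[OF h that] by simp
  have h_carr: "carrier ?A = h ` carrier ?R" unfolding h_def by (rule I.carrier_quotient)
  have h_eq: "h f = h g \<longleftrightarrow> f - g \<in> ?I" if "f \<in> carrier ?R" "g \<in> carrier ?R" for f g
    using R.quotient_eq_iff_same_a_r_cos[OF ideal_path_ideal that] a_minus_poly_ring_in[OF that(2)]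
    by (simp add: h_def)
  have h_zero: "h f = \<zero>\<^bsub>?A\<^esub> \<longleftrightarrow> f \<in> ?I" if "f \<in> carrier ?R" for f
    using R.mem_ideal_iff_coset_eq[OF ideal_path_ideal that] by (simp add: h_def FactRing_def)
  let ?o = "parity_sum m False :: 'k mpoly" and ?e = "parity_sum m True :: 'k mpoly"
  have carr: "?o \<in> carrier ?R" "?e \<in> carrier ?R" by (rule parity_sum_in_poly_ring_in)+
  have PIdl: "h f \<in> cgenideal ?A (h ?o) \<longleftrightarrow> (\<exists>g\<in>carrier ?R. f - ?o * g \<in> ?I)"
    if f: "f \<in> carrier ?R" for f
  proof -
    have "h f \<in> cgenideal ?A (h ?o) \<longleftrightarrow> (\<exists>g\<in>carrier ?R. h f = h g \<otimes>\<^bsub>?A\<^esub> h ?o)"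
      unfolding cgenideal_def h_carr by blast
    also have "\<dots> \<longleftrightarrow> (\<exists>g\<in>carrier ?R. h f = h (?o * g))"
      using h_mult[OF _ carr(1)] by (simp add: mult.commute)
    also have "\<dots> \<longleftrightarrow> (\<exists>g\<in>carrier ?R. f - ?o * g \<in> ?I)"
      using h_eq[OF f poly_ring_in_closed(2)[OF carr(1)]] by simp
    finally show ?thesis .
  qed
  show ?thesis
  proof (rule A.regular_sequence_pairI)
    show "h ?o \<in> carrier ?A" "h ?e \<in> carrier ?A" using carr h_carr by blast+
  next
    fix x assume x: "x \<in> carrier ?A" "h ?o \<otimes>\<^bsub>?A\<^esub> x = \<zero>\<^bsub>?A\<^esub>"
    then obtain f where f: "f \<in> carrier ?R" "x = h f" using h_carr by blast
    have "?o * f \<in> ?I"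
      using x(2) f h_mult[OF carr(1) f(1)] h_zero[OF poly_ring_in_closed(2)[OF carr(1) f(1)]] by simp
    then have "f \<in> ?I" using odd_sum_regular[OF _ f(1)] m by simp
    then show "x = \<zero>\<^bsub>?A\<^esub>" using f h_zero by simp
  next
    fix x assume x: "x \<in> carrier ?A" "h ?e \<otimes>\<^bsub>?A\<^esub> x \<in> cgenideal ?A (h ?o)"
    then obtain f where f: "f \<in> carrier ?R" "x = h f" using h_carr by blast
    obtain g where "?e * f - ?o * g \<in> ?I"
      using x(2) f h_mult[OF carr(2) f(1)] PIdl[OF poly_ring_in_closed(2)[OF carr(2) f(1)]] by auto
    then show "x \<in> cgenideal ?A (h ?o)"
      using even_sum_regular_mod_odd_sum[OF m f(1)] PIdl[OF f(1)] f(2) by simp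
  next
    have J: "ideal (h ` irrelevant_ideal m) ?A"
      unfolding h_def by (rule R.ring_ideal_imp_quot_ideal[OF ideal_path_ideal ideal_irrelevant_ideal])
    have "genideal ?A {h ?o, h ?e} \<subseteq> h ` irrelevant_ideal m"
      using parity_sum_in_irrelevant_ideal by (intro A.genideal_minimal[OF J]) blast
    moreover have "h 1 \<notin> h ` irrelevant_ideal m"
    proof
      assume "h 1 \<in> h ` irrelevant_ideal m"
      then obtain f where f: "f \<in> irrelevant_ideal m" "h 1 = h f" by blast
      have "f \<in> carrier ?R" using ideal_poly_ring_inD(5)[OF ideal_irrelevant_ideal f(1)] .
      from h_eq[OF one_in_poly_ring_in this] have "1 - f \<in> ?I" using f(2) by blast
      moreover have "Poly_Mapping.lookup (1 - f) 0 \<noteq> 0"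
        using lookup_0_irrelevant_ideal[OF f(1)] by (simp add: lookup_minus lookup_one)
      then have "0 \<in> Poly_Mapping.keys (1 - f)" by (simp add: in_keys_iff)
      moreover have "face 0" by (simp add: face_def)
      ultimately show False unfolding path_ideal_def by blast
    qed
    ultimately show "genideal ?A {h ?o, h ?e} \<noteq> carrier ?A"
      using h_carr one_in_poly_ring_in by blast
  qed
qed


section \<open>The Cohen--Macaulay property\<close>

theorem Cohen_Macaulay_path_ideal:
  assumes m: "m \<ge> 2"
  shows "Cohen_Macaulay_ideal m (path_ideal m :: 'k::field mpoly set)"
proof -
  let ?R = "poly_ring_in m :: 'k mpoly ring" and ?I = "path_ideal m :: 'k mpoly set"
  interpret A: cring "?R Quot ?I"
    by (rule ideal.quotient_is_cring[OF ideal_path_ideal cring_poly_ring_in])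
  let ?h = "\<lambda>f. ?I +>\<^bsub>?R\<^esub> f"
  let ?s = "[?h (parity_sum m False), ?h (parity_sum m True)]"
  have "set ?s \<subseteq> ?h ` irrelevant_ideal m" using parity_sum_in_irrelevant_ideal by auto
  then have "enat (length ?s) \<le> graded_depth m ?I"
    unfolding graded_depth_def depth_at_def
    using regular_sequence_parity_sums[OF m] by (intro Sup_upper) blast
  then have "2 \<le> graded_depth m ?I" by (simp add: numeral_eq_enat eval_nat_numeral)
  moreover have "graded_depth m ?I \<le> krull_dim (?R Quot ?I)"
    unfolding graded_depth_def by (rule A.depth_at_le_krull_dim)
  moreover have "krull_dim (?R Quot ?I) \<le> 2"
    using m by (intro krull_dim_path_quotient_le) simp
  ultimately show ?thesis unfolding Cohen_Macaulay_ideal_def by (meson order.antisym order.trans)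
qed

theorem theorem3p10:
  fixes n r :: nat
  assumes "n \<ge> 3"
  shows "Cohen_Macaulay_ideal (n + r)
    (Inc_ideal n (n + r)
      (edge_ideal n (complement_edges n (line_edges n)) :: 'k::field mpoly set))"
  unfolding Inc_ideal_eq_path_ideal[OF assms]
  using assms by (intro Cohen_Macaulay_path_ideal) simp

end
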